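(* Let $\Gamma$ be a finite dynamic game with ordinal preferences and perfect recall. There exists a profile $u^*=(u^*_j)_{j\in I}$ with $u^*_j\in\mathcal U_j$ for every $j\in I$ such that $\mathbb U^k_i(S)=\mathrm{SR}^k_i(S)[u^*]$ for every $i\in I$ and every $k\in\mathbb N$ (where $\mathbb U^k_i(S)$, $\mathrm{SR}^k_i(S)[u^*]$ denote the $i$-th components of $\mathbb U^k(S)$, $\mathrm{SR}^k(S)[u^*]$).
   Context: A finite dynamic game with ordinal preferences and perfect recall $\Gamma$ consists of: a finite set of players $I$; a finite rooted tree of histories (finite sequences of action profiles, simultaneous moves allowed) with terminal histories $Z$; for each $i$ a partition $H_i$ of the non-terminal histories where $i$ is active (at least two actions) into information sets with identical available actions; perfect recall; complete transitive preferences $\succsim_i$ on $Z$ (asymmetric part $\succ_i$). Strategies of $i$ are equivalence classes of behaviorally equivalent standard strategies (action assignments to $H_i$, identified when they allow the same information sets and prescribe the same actions there); $S_i$ is the finite set of strategies, $S=\prod_jS_j$, $S_{-i}=\prod_{j\ne i}S_j$, $\zeta:S\to Z$ the outcome map. For $h\in H_i$, $S_i(h)$, $S_{-i}(h)$ are strategies of $i$, resp. profiles of others, reaching $h$; $H_i(s_i)=\{h\in H_i:s_i\in S_i(h)\}$. A restriction is a nonempty $R=\prod_jR_j\subseteq S$; $R_i(h)=R_i\cap S_i(h)$, $R_{-i}(h)=R_{-i}\cap S_{-i}(h)$, $R^i(h)=R_i(h)\times R_{-i}(h)$. For $P=P_i\times P_{-i}$, $s_i\in P_i$ is weakly dominated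 relative to $P$ by $t_i\in P_i$ if $\zeta(t_i,s_{-i})\succsim_i\zeta(s_i,s_{-i})$ for all $s_{-i}\in P_{-i}$ with $\succ_i$ for some; B-dominated w.r.t. $P$ if for every nonempty $Q_{-i}\subseteq P_{-i}$ it is weakly dominated relative to $P_i\times Q_{-i}$ by some strategy in $P_i$. $s_i\in R_i$ is conditionally B-dominated w.r.t. $R$ if some $h\in H_i(s_i)$ has $R^i(h)\ne\emptyset$ and $s_i$ B-dominated w.r.t. $R^i(h)$. $\mathbb U_i(R)$: the $s_i\in R_i$ not conditionally B-dominated w.r.t. $R$; $\mathbb U(R)=\prod_j\mathbb U_j(R)$; $\mathbb U^0(S)=S$, $\mathbb U^n(S)=\mathbb U(\mathbb U^{n-1}(S))$. $\mathcal U_i$ is the set of $u_i:Z\to\mathbb R$ with $u_i(z)\ge u_i(z')\iff z\succsim_iz'$. $\mathcal H_i=\{S_{-i}(h):h\in H_i\}$; a CPS on $(S_{-i},\mathcal H_i)$ is a family of probability measures $\mu_i(\cdot\mid E)$ on $S_{-i}$, $E\in\mathcal H_i$, with $\mu_i(E\mid E)=1$ and $\mu_i(A\mid E)=\mu_i(A\mid E')\mu_i(E'\mid E)$ whenever $A\subseteq E'\subseteq E$; $\Delta^{\mathcal H_i}(R_{-i})$ is the set of CPSs with $\mu_i(R_{-i}(h)\mid S_{-i}(h))=1$ for every $h\in H_i$ with $R^i(h)\ne\emptyset$. Strong Rationalizability for a fixed profile $u=(u_j)$, $u_j\in\mathcal U_j$: $\mathrm{SR}_i(R)[u]$ is the set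 of $s^*_i\in R_i$ for which there is $\mu_i\in\Delta^{\mathcal H_i}(R_{-i})$ such that for every $h\in H_i(s^*_i)$ with $R^i(h)\ne\emptyset$, $s^*_i$ maximizes $s_i\mapsto\sum_{s_{-i}\in R_{-i}}u_i(\zeta(s_i,s_{-i}))\mu_i(\{s_{-i}\}\mid S_{-i}(h))$ over $s_i\in R_i(h)$; $\mathrm{SR}(R)[u]=\prod_j\mathrm{SR}_j(R)[u]$, $\mathrm{SR}^0(S)[u]=S$, $\mathrm{SR}^n(S)[u]=\mathrm{SR}(\mathrm{SR}^{n-1}(S)[u])[u]$. *)

theory Defs
  imports Complex_Main "HOL-Library.Disjoint_Sets"
begin

text \<open>Players form the finite type 'i (so I = UNIV). A history is a finite list of
action profiles (simultaneous moves allowed); inactive players have a single feasible action.\<close>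

type_synonym ('i,'a) hist = "('i \<Rightarrow> 'a) list"

record ('i,'a) game =
  hist :: "('i,'a) hist set"
  act  :: "'i \<Rightarrow> ('i,'a) hist \<Rightarrow> 'a set"
  info :: "'i \<Rightarrow> ('i,'a) hist set set"
  pref :: "'i \<Rightarrow> ('i,'a) hist \<Rightarrow> ('i,'a) hist \<Rightarrow> bool"

definition nonterm :: "('i,'a) game \<Rightarrow> ('i,'a) hist \<Rightarrow> bool" where
  "nonterm G h \<longleftrightarrow> h \<in> hist G \<and> (\<exists>p. h @ [p] \<in> hist G)"

definition terminal :: "('i,'a) game \<Rightarrow> ('i,'a) hist set" where
  "terminal G = {h \<in> hist G. \<not> (\<exists>p. h @ [p] \<in> hist G)}"

definition active :: "('i,'a) game \<Rightarrow> 'i \<Rightarrow> ('i,'a) hist \<Rightarrow> bool" where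
  "active G i h \<longleftrightarrow> nonterm G h \<and> (\<exists>a b. a \<in> act G i h \<and> b \<in> act G i h \<and> a \<noteq> b)"

definition cell :: "('i,'a) game \<Rightarrow> 'i \<Rightarrow> ('i,'a) hist \<Rightarrow> ('i,'a) hist set" where
  "cell G i h = (THE c. c \<in> info G i \<and> h \<in> c)"

definition experience :: "('i,'a) game \<Rightarrow> 'i \<Rightarrow> ('i,'a) hist \<Rightarrow> (('i,'a) hist set \<times> 'a) list" where
  "experience G i h =
     [(cell G i (take k h), (h ! k) i). k \<leftarrow> [0..<length h], active G i (take k h)]"

definition wf_game :: "('i::finite,'a) game \<Rightarrow> bool" where
  "wf_game G \<longleftrightarrow>
     finite (hist G) \<and> [] \<in> hist G \<and>
     (\<forall>h g. h @ g \<in> hist G \<longrightarrow> h \<in> hist G) \<and>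
     (\<forall>h. nonterm G h \<longrightarrow> (\<forall>p. h @ [p] \<in> hist G \<longleftrightarrow> (\<forall>i. p i \<in> act G i h))) \<and>
     (\<forall>i. partition_on {h. active G i h} (info G i)) \<and>
     (\<forall>i. \<forall>c\<in>info G i. \<forall>h\<in>c. \<forall>h'\<in>c. act G i h = act G i h') \<and>
     (\<forall>i. \<forall>c\<in>info G i. \<forall>h\<in>c. \<forall>h'\<in>c. experience G i h = experience G i h') \<and>
     (\<forall>i. \<forall>z\<in>terminal G. \<forall>z'\<in>terminal G. pref G i z z' \<or> pref G i z' z) \<and>
     (\<forall>i. \<forall>z\<in>terminal G. \<forall>z'\<in>terminal G. \<forall>z''\<in>terminal G.
          pref G i z z' \<longrightarrow> pref G i z' z'' \<longrightarrow> pref G i z z'')"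

definition spref :: "('i,'a) game \<Rightarrow> 'i \<Rightarrow> ('i,'a) hist \<Rightarrow> ('i,'a) hist \<Rightarrow> bool" where
  "spref G i z z' \<longleftrightarrow> pref G i z z' \<and> \<not> pref G i z' z"

section \<open>Strategies (reduced: canonical representatives of behavioural-equivalence classes)\<close>

type_synonym ('i,'a) strat = "('i,'a) hist set \<Rightarrow> 'a option"

definition allows :: "('i,'a) game \<Rightarrow> 'i \<Rightarrow> ('i,'a) strat \<Rightarrow> ('i,'a) hist \<Rightarrow> bool" where
  "allows G i f x \<longleftrightarrow>
     (\<forall>k<length x. active G i (take k x) \<longrightarrow> f (cell G i (take k x)) = Some ((x ! k) i))"

definition allowed_cell :: "('i,'a) game \<Rightarrow> 'i \<Rightarrow> ('i,'a) strat \<Rightarrow> ('i,'a) hist set \<Rightarrow> bool" where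
  "allowed_cell G i f c \<longleftrightarrow> (\<exists>x\<in>c. allows G i f x)"

definition std_strat :: "('i,'a) game \<Rightarrow> 'i \<Rightarrow> (('i,'a) hist set \<Rightarrow> 'a) set" where
  "std_strat G i = {\<sigma>. \<forall>c\<in>info G i. \<forall>h\<in>c. \<sigma> c \<in> act G i h}"

text \<open>Two standard strategies are behaviourally equivalent iff they have the same reduction.\<close>
definition reduce :: "('i,'a) game \<Rightarrow> 'i \<Rightarrow> (('i,'a) hist set \<Rightarrow> 'a) \<Rightarrow> ('i,'a) strat" where
  "reduce G i \<sigma> = (\<lambda>c. if c \<in> info G i \<and> allowed_cell G i (Some \<circ> \<sigma>) c then Some (\<sigma> c) else None)"

definition Strat :: "('i,'a) game \<Rightarrow> 'i \<Rightarrow> ('i,'a) strat set" where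
  "Strat G i = reduce G i ` std_strat G i"

definition Prof :: "('i,'a) game \<Rightarrow> ('i \<Rightarrow> ('i,'a) strat) set" where
  "Prof G = {s. \<forall>j. s j \<in> Strat G j}"

definition reaches :: "('i,'a) game \<Rightarrow> ('i \<Rightarrow> ('i,'a) strat) \<Rightarrow> ('i,'a) hist \<Rightarrow> bool" where
  "reaches G s x \<longleftrightarrow> x \<in> hist G \<and> (\<forall>j. allows G j (s j) x)"

definition outcome :: "('i,'a) game \<Rightarrow> ('i \<Rightarrow> ('i,'a) strat) \<Rightarrow> ('i,'a) hist" where
  "outcome G s = (THE z. z \<in> terminal G \<and> reaches G s z)"

text \<open>S_i(h) and S_{-i}(h) for an information set c; profiles of the others are
extensional functions on - {i}.\<close>
definition StratAt :: "('i,'a) game \<Rightarrow> 'i \<Rightarrow> ('i,'a) hist set \<Rightarrow> ('i,'a) strat set" where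
  "StratAt G i c = {s i | s. s \<in> Prof G \<and> (\<exists>x\<in>c. reaches G s x)}"

definition OthAt :: "('i,'a) game \<Rightarrow> 'i \<Rightarrow> ('i,'a) hist set \<Rightarrow> ('i \<Rightarrow> ('i,'a) strat) set" where
  "OthAt G i c = {restrict s (- {i}) | s. s \<in> Prof G \<and> (\<exists>x\<in>c. reaches G s x)}"

definition Hs :: "('i,'a) game \<Rightarrow> 'i \<Rightarrow> ('i,'a) strat \<Rightarrow> ('i,'a) hist set set" where
  "Hs G i t = {c \<in> info G i. t \<in> StratAt G i c}"

text \<open>A restriction is given componentwise, R :: 'i => strategy set; R_{-i}:\<close>
definition Oth :: "('i \<Rightarrow> ('i,'a) strat set) \<Rightarrow> 'i \<Rightarrow> ('i \<Rightarrow> ('i,'a) strat) set" where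
  "Oth R i = PiE (- {i}) R"

definition nonempty_at :: "('i,'a) game \<Rightarrow> ('i \<Rightarrow> ('i,'a) strat set) \<Rightarrow> 'i \<Rightarrow> ('i,'a) hist set \<Rightarrow> bool" where
  "nonempty_at G R i c \<longleftrightarrow> R i \<inter> StratAt G i c \<noteq> {} \<and> Oth R i \<inter> OthAt G i c \<noteq> {}"

definition wdom :: "('i,'a) game \<Rightarrow> 'i \<Rightarrow> ('i,'a) strat set \<Rightarrow> ('i \<Rightarrow> ('i,'a) strat) set
                     \<Rightarrow> ('i,'a) strat \<Rightarrow> ('i,'a) strat \<Rightarrow> bool" where
  "wdom G i P Q t s \<longleftrightarrow> s \<in> P \<and> t \<in> P \<and>
     (\<forall>y\<in>Q. pref G i (outcome G (y(i := t))) (outcome G (y(i := s)))) \<and>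
     (\<exists>y\<in>Q. spref G i (outcome G (y(i := t))) (outcome G (y(i := s))))"

definition Bdom :: "('i,'a) game \<Rightarrow> 'i \<Rightarrow> ('i,'a) strat set \<Rightarrow> ('i \<Rightarrow> ('i,'a) strat) set
                     \<Rightarrow> ('i,'a) strat \<Rightarrow> bool" where
  "Bdom G i P Q s \<longleftrightarrow> s \<in> P \<and> (\<forall>Q'. Q' \<subseteq> Q \<and> Q' \<noteq> {} \<longrightarrow> (\<exists>t\<in>P. wdom G i P Q' t s))"

definition condB :: "('i,'a) game \<Rightarrow> ('i \<Rightarrow> ('i,'a) strat set) \<Rightarrow> 'i \<Rightarrow> ('i,'a) strat \<Rightarrow> bool" where
  "condB G R i s \<longleftrightarrow> s \<in> R i \<and>
     (\<exists>c\<in>Hs G i s. nonempty_at G R i c \<and>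
        Bdom G i (R i \<inter> StratAt G i c) (Oth R i \<inter> OthAt G i c) s)"

definition Uop :: "('i,'a) game \<Rightarrow> ('i \<Rightarrow> ('i,'a) strat set) \<Rightarrow> ('i \<Rightarrow> ('i,'a) strat set)" where
  "Uop G R = (\<lambda>i. {s \<in> R i. \<not> condB G R i s})"

definition Uit :: "('i,'a) game \<Rightarrow> nat \<Rightarrow> ('i \<Rightarrow> ('i,'a) strat set)" where
  "Uit G n = (Uop G ^^ n) (Strat G)"

definition is_util :: "('i,'a) game \<Rightarrow> 'i \<Rightarrow> (('i,'a) hist \<Rightarrow> real) \<Rightarrow> bool" where
  "is_util G i v \<longleftrightarrow> (\<forall>z\<in>terminal G. \<forall>z'\<in>terminal G. v z \<ge> v z' \<longleftrightarrow> pref G i z z')"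

text \<open>Conditional probability systems on S_{-i}, given by probability mass functions
mu E (E a conditioning event in the family H_i = S_{-i}(h), h in H_i).\<close>
definition cps :: "('i,'a) game \<Rightarrow> 'i \<Rightarrow>
     (('i \<Rightarrow> ('i,'a) strat) set \<Rightarrow> ('i \<Rightarrow> ('i,'a) strat) \<Rightarrow> real) \<Rightarrow> bool" where
  "cps G i \<mu> \<longleftrightarrow>
     (\<forall>E\<in>OthAt G i ` info G i.
        (\<forall>x. 0 \<le> \<mu> E x) \<and> (\<forall>x. x \<notin> Oth (Strat G) i \<longrightarrow> \<mu> E x = 0) \<and>
        sum (\<mu> E) (Oth (Strat G) i) = 1 \<and> sum (\<mu> E) E = 1) \<and>
     (\<forall>A E E'. E \<in> OthAt G i ` info G i \<longrightarrow> E' \<in> OthAt G i ` info G i \<longrightarrow>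
        A \<subseteq> E' \<longrightarrow> E' \<subseteq> E \<longrightarrow> sum (\<mu> E) A = sum (\<mu> E') A * sum (\<mu> E) E')"

definition cps_on :: "('i,'a) game \<Rightarrow> ('i \<Rightarrow> ('i,'a) strat set) \<Rightarrow> 'i \<Rightarrow>
     (('i \<Rightarrow> ('i,'a) strat) set \<Rightarrow> ('i \<Rightarrow> ('i,'a) strat) \<Rightarrow> real) \<Rightarrow> bool" where
  "cps_on G R i \<mu> \<longleftrightarrow> cps G i \<mu> \<and>
     (\<forall>c\<in>info G i. nonempty_at G R i c \<longrightarrow> sum (\<mu> (OthAt G i c)) (Oth R i \<inter> OthAt G i c) = 1)"

definition EU :: "('i,'a) game \<Rightarrow> ('i \<Rightarrow> ('i,'a) strat set) \<Rightarrow> ('i \<Rightarrow> ('i,'a) hist \<Rightarrow> real) \<Rightarrow> 'i \<Rightarrow>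
     (('i \<Rightarrow> ('i,'a) strat) set \<Rightarrow> ('i \<Rightarrow> ('i,'a) strat) \<Rightarrow> real) \<Rightarrow> ('i,'a) hist set \<Rightarrow> ('i,'a) strat \<Rightarrow> real" where
  "EU G R u i \<mu> c t = (\<Sum>y\<in>Oth R i. u i (outcome G (y(i := t))) * \<mu> (OthAt G i c) y)"

definition SRop :: "('i,'a) game \<Rightarrow> ('i \<Rightarrow> ('i,'a) hist \<Rightarrow> real) \<Rightarrow>
     ('i \<Rightarrow> ('i,'a) strat set) \<Rightarrow> ('i \<Rightarrow> ('i,'a) strat set)" where
  "SRop G u R = (\<lambda>i. {s \<in> R i. \<exists>\<mu>. cps_on G R i \<mu> \<and>
      (\<forall>c\<in>Hs G i s. nonempty_at G R i c \<longrightarrow>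
         (\<forall>t\<in>R i \<inter> StratAt G i c. EU G R u i \<mu> c t \<le> EU G R u i \<mu> c s))})"

definition SRit :: "('i,'a) game \<Rightarrow> ('i \<Rightarrow> ('i,'a) hist \<Rightarrow> real) \<Rightarrow> nat \<Rightarrow> ('i \<Rightarrow> ('i,'a) strat set)" where
  "SRit G u n = (SRop G u ^^ n) (Strat G)"

end

theory Submission
  imports Defs
begin

text \<open>The utilities are extremely risk averse: moving one indifference class down costs more than
  all possible gains in the other states together. Hence a strategy that is undominated on some set
  of states is a best reply to the belief on that set that weights each state by the inverse of the
  utility gap there, and one utility function serves all restrictions at once.

  To combine these local beliefs into a CPS, note that at every stage the surviving strategies are
  sequentially optimal, among all strategies, under a system that strongly believes each previous
  stage. Given such a system for an undominated s, insert lexicographically, in order of depth, a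
  local belief at each information set not charged so far. Since the predecessors give that
  information set probability 0, switching from s to the best continuation there survives the stage
  too; this makes s optimal there among all strategies, and Bayesian updating carries the optimality
  to later information sets.\<close>

section \<open>Conditioning\<close>

text \<open>The obstacle is that nothing keeps the survivors of a stage closed under splicing:
  following one survivor up to an information set and another from there on may give an eliminated
  strategy. Being a best reply among survivors at \<open>c\<close> therefore says little about later
  information sets. Optimality among all strategies, in contrast, passes to later sets by updating
  and is kept by any deviation that the earlier beliefs give probability 0. The characterisation
  \<open>seq_rat\<close> of one stage is what certifies such deviations as survivors when the next
  stage is treated, so it is proved in the same induction as the equality of the procedures. Only
  the passage from undominated strategies to beliefs uses the special utility; the converse holds
  for every utility that represents the preferences.\<close>

lemma finite_ranked_induct:
  fixes f :: "'b \<Rightarrow> nat"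
  assumes fin: "finite A" and empty: "P {}"
    and step: "\<And>D x. D \<subseteq> A \<Longrightarrow> x \<in> A - D \<Longrightarrow> (\<And>y. y \<in> D \<Longrightarrow> f y \<le> f x) \<Longrightarrow>
      (\<And>y. y \<in> A \<Longrightarrow> f y < f x \<Longrightarrow> y \<in> D) \<Longrightarrow> P D \<Longrightarrow> P (insert x D)"
  shows "P A"
proof -
  have "\<exists>D\<subseteq>A. card D = n \<and> (\<forall>y\<in>D. \<forall>x\<in>A - D. f y \<le> f x) \<and> P D" if "n \<le> card A" for n
    using that
  proof (induction n)
    case 0
    then show ?case using empty by (intro exI[of _ "{}"]) auto
  next
    case (Suc n)
    then obtain D where D: "D \<subseteq> A" "card D = n" "\<forall>y\<in>D. \<forall>x\<in>A - D. f y \<le> f x" "P D" by auto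
    then have ne: "finite (A - D)" "A - D \<noteq> {}" using Suc.prems fin by auto
    define x where "x = arg_min_on f (A - D)"
    \<comment> \<open>A remaining element of least rank keeps \<open>D\<close> an initial segment.
      Elements of equal rank may enter in any order, which is why \<open>step\<close> offers one
      weak and one strict comparison.\<close>
    have x: "x \<in> A - D" "\<And>y. y \<in> A - D \<Longrightarrow> f x \<le> f y"
      unfolding x_def using arg_min_if_finite[OF ne, of f] by (auto simp: not_less)
    have "P (insert x D)"
      using x D by (intro step) (auto simp: not_less[symmetric])
    moreover have "card (insert x D) = Suc n" using D(1,2) x(1) finite_subset[OF D(1) fin] by auto
    ultimately show ?case using x D by (intro exI[of _ "insert x D"]) auto
  qed
  from this[of "card A"] show ?thesis using card_subset_eq[OF fin] by auto
qed

definition condition :: "('b \<Rightarrow> real) \<Rightarrow> 'b set \<Rightarrow> 'b \<Rightarrow> real" where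
  "condition w E = (\<lambda>x. if x \<in> E then w x / sum w E else 0)"

text \<open>One level of a lexicographic system: \<open>w\<close> decides every event that it
  charges, all others fall through to \<open>\<mu>\<close>. The weights need not be
  normalised.\<close>

definition glue :: "('b \<Rightarrow> real) \<Rightarrow> ('b set \<Rightarrow> 'b \<Rightarrow> real) \<Rightarrow> 'b set \<Rightarrow> 'b \<Rightarrow> real" where
  "glue w \<mu> E = (if sum w E > 0 then condition w E else \<mu> E)"

text \<open>The head of the list has priority, so \<open>L @ [w]\<close> ranks \<open>w\<close>
  behind all of \<open>L\<close> but ahead of the base system \<open>\<mu>\<close>.\<close>

abbreviation lex_cps :: "('b \<Rightarrow> real) list \<Rightarrow> ('b set \<Rightarrow> 'b \<Rightarrow> real) \<Rightarrow> 'b set \<Rightarrow> 'b \<Rightarrow> real" where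
  "lex_cps L \<mu> \<equiv> foldr glue L \<mu>"

lemma lex_cps_hit: "\<exists>w\<in>set L. sum w E > 0 \<Longrightarrow> lex_cps L \<mu> E = lex_cps L \<mu>' E"
  by (induction L) (auto simp: glue_def)

lemma lex_cps_no_hit: "\<forall>w\<in>set L. \<not> sum w E > 0 \<Longrightarrow> lex_cps L \<mu> E = \<mu> E"
  by (induction L) (auto simp: glue_def)

text \<open>The belief at \<open>E\<close> is the conditional of a single weight in
  \<open>L\<close>, and that weight vanishes on \<open>F\<close>. This is how charged information
  sets come to give probability 0 to one that is still uncharged.\<close>

lemma lex_cps_zero:
  assumes "\<exists>w\<in>set L. sum w E > 0" "\<forall>w\<in>set L. \<forall>y. 0 \<le> w y" "\<forall>w\<in>set L. \<not> sum w F > 0"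
    "finite F" "y \<in> F"
  shows "lex_cps L \<mu> E y = 0"
  using assms(1-3)
proof (induction L)
  case (Cons w L)
  show ?case
  proof (cases "sum w E > 0")
    case True
    have "sum w F = 0" using Cons.prems sum_nonneg[of F w] by (simp add: not_less order.antisym)
    then have "w y = 0" using Cons.prems assms(4,5) by (simp add: sum_nonneg_eq_0_iff)
    then show ?thesis using True by (simp add: glue_def condition_def)
  qed (use Cons in \<open>auto simp: glue_def\<close>)
qed simp

section \<open>Histories and strategies\<close>

locale ordinal_game =
  fixes G :: "('i::finite, 'a) game"
  assumes wf: "wf_game G"
begin

lemma finite_hist: "finite (hist G)"
  and Nil_hist: "[] \<in> hist G"
  and hist_appendD: "h @ g \<in> hist G \<Longrightarrow> h \<in> hist G"
  and hist_snoc_iff: "nonterm G h \<Longrightarrow> h @ [p] \<in> hist G \<longleftrightarrow> (\<forall>i. p i \<in> act G i h)"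
  and info_partition: "partition_on {h. active G i h} (info G i)"
  and act_cell_eq: "c \<in> info G i \<Longrightarrow> h \<in> c \<Longrightarrow> h' \<in> c \<Longrightarrow> act G i h = act G i h'"
  and perfect_recall: "c \<in> info G i \<Longrightarrow> h \<in> c \<Longrightarrow> h' \<in> c \<Longrightarrow> experience G i h = experience G i h'"
  and pref_total: "z \<in> terminal G \<Longrightarrow> z' \<in> terminal G \<Longrightarrow> pref G i z z' \<or> pref G i z' z"
  and pref_trans: "z \<in> terminal G \<Longrightarrow> z' \<in> terminal G \<Longrightarrow> z'' \<in> terminal G \<Longrightarrow>
     pref G i z z' \<Longrightarrow> pref G i z' z'' \<Longrightarrow> pref G i z z''"
proof -
  note w = wf[unfolded wf_game_def]
  show "finite (hist G)" "[] \<in> hist G" "partition_on {h. active G i h} (info G i)"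
    using w by simp_all
  show "h @ g \<in> hist G \<Longrightarrow> h \<in> hist G" using w by metis
  show "nonterm G h \<Longrightarrow> h @ [p] \<in> hist G \<longleftrightarrow> (\<forall>i. p i \<in> act G i h)" using w by simp
  show "c \<in> info G i \<Longrightarrow> h \<in> c \<Longrightarrow> h' \<in> c \<Longrightarrow> act G i h = act G i h'" using w by metis
  show "c \<in> info G i \<Longrightarrow> h \<in> c \<Longrightarrow> h' \<in> c \<Longrightarrow> experience G i h = experience G i h'"
    using w by metis
  show "z \<in> terminal G \<Longrightarrow> z' \<in> terminal G \<Longrightarrow> pref G i z z' \<or> pref G i z' z" using w by metis
  show "z \<in> terminal G \<Longrightarrow> z' \<in> terminal G \<Longrightarrow> z'' \<in> terminal G \<Longrightarrow>
     pref G i z z' \<Longrightarrow> pref G i z' z'' \<Longrightarrow> pref G i z z''" using w by metis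
qed

lemma hist_take: "x \<in> hist G \<Longrightarrow> take k x \<in> hist G"
  using hist_appendD[of "take k x" "drop k x"] by simp

lemma cell_active:
  assumes "active G i h"
  shows "cell G i h \<in> info G i" and "h \<in> cell G i h"
proof -
  have "\<exists>!c. c \<in> info G i \<and> h \<in> c"
    using info_partition[of i] assms unfolding partition_on_def disjoint_def by blast
  from theI'[OF this] show "cell G i h \<in> info G i" and "h \<in> cell G i h"
    unfolding cell_def by auto
qed

lemma active_mem: "c \<in> info G i \<Longrightarrow> h \<in> c \<Longrightarrow> active G i h"
  using info_partition[of i] unfolding partition_on_def by blast

lemma info_disjoint: "c \<in> info G i \<Longrightarrow> d \<in> info G i \<Longrightarrow> h \<in> c \<Longrightarrow> h \<in> d \<Longrightarrow> c = d"
  using info_partition[of i] unfolding partition_on_def disjoint_def by blast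

lemma cell_eq: "c \<in> info G i \<Longrightarrow> h \<in> c \<Longrightarrow> cell G i h = c"
  using cell_active[OF active_mem] info_disjoint by metis

lemma info_nonempty: "c \<in> info G i \<Longrightarrow> \<exists>x. x \<in> c"
  using info_partition[of i] unfolding partition_on_def by (metis ex_in_conv)

lemma active_hist: "active G i x \<Longrightarrow> x \<in> hist G"
  unfolding active_def nonterm_def by blast

lemma mem_hist: "c \<in> info G i \<Longrightarrow> x \<in> c \<Longrightarrow> x \<in> hist G"
  using active_mem active_hist by blast

lemma finite_info: "finite (info G i)"
proof (rule finite_subset)
  show "info G i \<subseteq> Pow (hist G)" using mem_hist by blast
qed (simp add: finite_hist)

section \<open>Experience of a player along a history\<close>

lemma experience_snoc:
  "experience G i (x @ [p]) = experience G i x @ (if active G i x then [(cell G i x, p i)] else [])"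
proof -
  have "experience G i (x @ [p])
      = concat (map (\<lambda>k. if active G i (take k (x @ [p]))
          then [(cell G i (take k (x @ [p])), ((x @ [p]) ! k) i)] else []) [0..<length x])
        @ (if active G i x then [(cell G i x, p i)] else [])"
    unfolding experience_def by simp
  also have "map (\<lambda>k. if active G i (take k (x @ [p]))
          then [(cell G i (take k (x @ [p])), ((x @ [p]) ! k) i)] else []) [0..<length x]
     = map (\<lambda>k. if active G i (take k x) then [(cell G i (take k x), (x ! k) i)] else []) [0..<length x]"
    by (rule map_cong) (auto simp: nth_append)
  finally show ?thesis unfolding experience_def by simp
qed

lemma experience_append: "\<exists>e. experience G i (x @ w) = experience G i x @ e"
proof (induction w rule: rev_induct)
  case (snoc p w)
  then show ?case using experience_snoc[of i "x @ w" p] by auto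
qed simp

lemma experience_append_active:
  assumes "active G i x" "w \<noteq> []"
  shows "\<exists>a e. experience G i (x @ w) = experience G i x @ (cell G i x, a) # e"
proof -
  obtain p v where "w = p # v" using assms(2) by (cases w) auto
  then show ?thesis
    using experience_append[of i "x @ [p]" v] experience_snoc[of i x p] assms(1) by auto
qed

lemma set_experience:
  "set (experience G i x) =
     {(cell G i (take k x), (x ! k) i) | k. k < length x \<and> active G i (take k x)}"
  unfolding experience_def by auto

text \<open>The experience records exactly the own choices that a strategy has to match. Hence
  perfect recall, an equality of experiences within an information set, makes \<open>allows\<close>
  constant there (\<open>allows_mem\<close>).\<close>

lemma allows_iff: "allows G i f x \<longleftrightarrow> (\<forall>(d, a)\<in>set (experience G i x). f d = Some a)"
  unfolding set_experience allows_def by auto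

lemma allows_appendD: "allows G i f (x @ w) \<Longrightarrow> allows G i f x"
  using experience_append[of i x w] unfolding allows_iff by auto

lemma allows_take: "allows G i f x \<Longrightarrow> allows G i f (take k x)"
  using allows_appendD[of i f "take k x" "drop k x"] by simp

lemma allows_snoc:
  "allows G i f (x @ [p]) \<longleftrightarrow> allows G i f x \<and> (active G i x \<longrightarrow> f (cell G i x) = Some (p i))"
  unfolding allows_iff experience_snoc by auto

lemma allows_mem: "c \<in> info G i \<Longrightarrow> x \<in> c \<Longrightarrow> x' \<in> c \<Longrightarrow> allows G i f x \<Longrightarrow> allows G i f x'"
  using perfect_recall unfolding allows_iff by metis

lemma experience_split:
  assumes "(d, a) \<in> set (experience G i x)" "x \<in> hist G"
  obtains k where "k < length x" "take k x \<in> d" "d \<in> info G i" "cell G i (take k x) = d"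
    "a = (x ! k) i"
proof -
  obtain k where "k < length x" "active G i (take k x)" "d = cell G i (take k x)" "a = (x ! k) i"
    using assms(1) unfolding set_experience by blast
  then show thesis using cell_active[of i "take k x"] that by blast
qed

text \<open>An earlier visit to \<open>c\<close> would make the experience at \<open>x\<close> a
  proper extension of the one at the earlier member of \<open>c\<close>, whereas perfect recall
  makes them equal.\<close>

lemma experience_no_repeat:
  assumes "c \<in> info G i" "x \<in> c"
  shows "c \<notin> fst ` set (experience G i x)"
proof
  assume "c \<in> fst ` set (experience G i x)"
  then obtain a where "(c, a) \<in> set (experience G i x)" by auto
  then obtain k where k: "k < length x" "take k x \<in> c"
    using experience_split mem_hist[OF assms] by metis
  then have "active G i (take k x)" "drop k x \<noteq> []" using active_mem assms by auto
  from experience_append_active[OF this] perfect_recall[OF assms(1) assms(2) k(2)]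
  show False by auto
qed

text \<open>Two positions of \<open>x\<close> in the same cell must coincide: otherwise the cell
  would occur in the experience at the later one.\<close>

lemma experience_functional:
  assumes "(d, a) \<in> set (experience G i x)" "(d, b) \<in> set (experience G i x)" "x \<in> hist G"
  shows "a = b"
proof -
  obtain k where k: "k < length x" "take k x \<in> d" "d \<in> info G i" "a = (x ! k) i"
    using experience_split assms by metis
  obtain l where l: "l < length x" "take l x \<in> d" "b = (x ! l) i"
    using experience_split assms by metis
  have *: "\<not> m < n" if "take m x \<in> d" "take n x \<in> d" "n < length x" for m n
  proof
    assume "m < n"
    then have "take n x = take m x @ take (n - m) (drop m x)" "take (n - m) (drop m x) \<noteq> []"
      using that(3) by (auto simp: take_add[symmetric])
    moreover have "active G i (take m x)" using active_mem k(3) that by auto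
    ultimately have "d \<in> fst ` set (experience G i (take n x))"
      using experience_append_active[of i "take m x" "take (n - m) (drop m x)"]
        cell_eq[OF k(3) that(1)] by auto
    then show False using experience_no_repeat[OF k(3) that(2)] by blast
  qed
  have "k = l" using *[of k l] *[of l k] k l by linarith
  then show ?thesis using k l by simp
qed

section \<open>Existence and finiteness of strategies\<close>

lemma nonterm_act_nonempty: "nonterm G h \<Longrightarrow> \<exists>a. a \<in> act G i h"
  using hist_snoc_iff unfolding nonterm_def by blast

lemma std_strat_nonempty: "\<exists>\<sigma>. \<sigma> \<in> std_strat G i"
proof -
  have "\<exists>a. \<forall>h\<in>c. a \<in> act G i h" if c: "c \<in> info G i" for c
  proof -
    obtain x where x: "x \<in> c" using info_nonempty[OF c] by blast
    then obtain a where "a \<in> act G i x" using active_mem[OF c x] unfolding active_def by blast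
    then show ?thesis using act_cell_eq[OF c x] by blast
  qed
  then obtain \<sigma> where "\<forall>c\<in>info G i. \<forall>h\<in>c. \<sigma> c \<in> act G i h" by metis
  then show ?thesis unfolding std_strat_def by blast
qed

text \<open>Reduction erases only choices at cells that the strategy itself excludes, and these are
  never met along a history it allows.\<close>

lemma allows_reduce: "x \<in> hist G \<Longrightarrow> allows G i (reduce G i \<sigma>) x \<longleftrightarrow> allows G i (Some \<circ> \<sigma>) x"
proof (induction x rule: rev_induct)
  case (snoc p x)
  show ?case
  proof (cases "active G i x")
    case True
    have "reduce G i \<sigma> (cell G i x) = Some (\<sigma> (cell G i x))" if "allows G i (Some \<circ> \<sigma>) x"
      using that cell_active[OF True] unfolding reduce_def allowed_cell_def by auto
    then show ?thesis using snoc hist_appendD[of x "[p]"] True by (auto simp: allows_snoc comp_def)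
  next
    case False
    then show ?thesis using snoc hist_appendD[of x "[p]"] by (simp add: allows_snoc)
  qed
qed (simp add: allows_def)

lemma Strat_action:
  assumes "t \<in> Strat G i" "active G i x" "allows G i t x"
  shows "\<exists>a\<in>act G i x. t (cell G i x) = Some a"
proof -
  obtain \<sigma> where \<sigma>: "\<sigma> \<in> std_strat G i" "t = reduce G i \<sigma>"
    using assms(1) unfolding Strat_def by auto
  have "allows G i (Some \<circ> \<sigma>) x"
    using assms(3) allows_reduce active_hist[OF assms(2)] \<sigma>(2) by auto
  then have "t (cell G i x) = Some (\<sigma> (cell G i x))"
    unfolding \<sigma>(2) reduce_def allowed_cell_def using cell_active[OF assms(2)] by auto
  then show ?thesis using \<sigma>(1) cell_active[OF assms(2)] unfolding std_strat_def by auto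
qed

lemma Strat_allows_ex:
  assumes "x \<in> hist G"
  shows "\<exists>t\<in>Strat G i. allows G i t x"
proof -
  obtain \<sigma> where \<sigma>: "\<sigma> \<in> std_strat G i" using std_strat_nonempty by blast
  \<comment> \<open>Play the recorded action on the way to \<open>x\<close> and the default
    \<open>\<sigma>\<close> elsewhere; by \<open>experience_functional\<close> the recorded action
    is unique, so \<open>SOME\<close> has no freedom.\<close>
  define \<tau> where "\<tau> = (\<lambda>d. if \<exists>a. (d, a) \<in> set (experience G i x)
    then (SOME a. (d, a) \<in> set (experience G i x)) else \<sigma> d)"
  have \<tau>: "\<tau> d = a" if "(d, a) \<in> set (experience G i x)" for d a
    using that experience_functional[OF _ _ assms] someI[of "\<lambda>a. (d, a) \<in> set (experience G i x)" a]
    unfolding \<tau>_def by auto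
  have "\<tau> c \<in> act G i h" if c: "c \<in> info G i" "h \<in> c" for c h
  proof (cases "\<exists>a. (c, a) \<in> set (experience G i x)")
    case True
    then obtain a where a: "(c, a) \<in> set (experience G i x)" by blast
    then obtain k where k: "k < length x" "take k x \<in> c" "a = (x ! k) i"
      using experience_split assms by metis
    have "take (Suc k) x \<in> hist G" using hist_take assms by blast
    then have "take k x @ [x ! k] \<in> hist G" using k(1) by (simp add: take_Suc_conv_app_nth)
    moreover have "nonterm G (take k x)" using active_mem[OF c(1) k(2)] unfolding active_def by blast
    ultimately have "a \<in> act G i (take k x)" using hist_snoc_iff k(3) by blast
    then show ?thesis using \<tau>[OF a] act_cell_eq[OF c(1) c(2) k(2)] by simp
  next
    case False
    then show ?thesis using \<sigma> c unfolding \<tau>_def std_strat_def by auto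
  qed
  then have "reduce G i \<tau> \<in> Strat G i" unfolding Strat_def std_strat_def by auto
  moreover have "allows G i (reduce G i \<tau>) x"
    unfolding allows_reduce[OF assms] using \<tau> unfolding allows_iff by auto
  ultimately show ?thesis by blast
qed

text \<open>The type of actions may be infinite, but every available action occurs in the last
  profile of some history, and there are finitely many histories.\<close>

lemma finite_act: "active G i h \<Longrightarrow> finite (act G i h)"
proof -
  assume "active G i h"
  then have n: "nonterm G h" unfolding active_def by blast
  then obtain p where "h @ [p] \<in> hist G" unfolding nonterm_def by blast
  then have p: "\<And>j. p j \<in> act G j h" using hist_snoc_iff[OF n] by blast
  have "act G i h \<subseteq> (\<lambda>x. (last x) i) ` hist G"
  proof
    fix a assume "a \<in> act G i h"
    then have "h @ [p(i := a)] \<in> hist G" using p hist_snoc_iff[OF n] by simp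
    then show "a \<in> (\<lambda>x. (last x) i) ` hist G" by (rule rev_image_eqI) simp
  qed
  then show ?thesis using finite_hist finite_surj by blast
qed

lemma finite_Strat: "finite (Strat G i)"
proof (rule finite_subset)
  let ?B = "insert None (Some ` (\<Union>h\<in>{h\<in>hist G. active G i h}. act G i h))"
  show "Strat G i \<subseteq> {f. \<forall>c. (c \<in> info G i \<longrightarrow> f c \<in> ?B) \<and> (c \<notin> info G i \<longrightarrow> f c = None)}"
  proof (intro subsetI CollectI allI conjI impI)
    fix t c assume "t \<in> Strat G i"
    then obtain \<sigma> where \<sigma>: "\<sigma> \<in> std_strat G i" "t = reduce G i \<sigma>" unfolding Strat_def by auto
    show "t c = None" if "c \<notin> info G i" using \<sigma>(2) that unfolding reduce_def by simp
    assume c: "c \<in> info G i"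
    then obtain x where x: "x \<in> c" using info_nonempty by blast
    then have "\<sigma> c \<in> act G i x" using \<sigma>(1) c unfolding std_strat_def by blast
    then show "t c \<in> ?B" using active_mem[OF c x] mem_hist[OF c x] \<sigma>(2) unfolding reduce_def by auto
  qed
  show "finite {f. \<forall>c. (c \<in> info G i \<longrightarrow> f c \<in> ?B) \<and> (c \<notin> info G i \<longrightarrow> f c = None)}"
    using finite_act by (intro finite_set_of_finite_funs finite_info) (auto simp: finite_hist)
qed

abbreviation "Y \<equiv> Oth (Strat G)"

lemma finite_Oth: "finite (Y i)"
  unfolding Oth_def by (intro finite_PiE) (auto simp: finite_Strat)

lemma Prof_upd: "y \<in> Y i \<Longrightarrow> t \<in> Strat G i \<Longrightarrow> y(i := t) \<in> Prof G"
  unfolding Oth_def Prof_def by (auto simp: PiE_iff)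

section \<open>Paths and outcomes of strategy profiles\<close>

lemma reaches_appendD: "reaches G s (x @ w) \<Longrightarrow> reaches G s x"
  unfolding reaches_def using hist_appendD allows_appendD by blast

lemma reaches_comparable:
  assumes "reaches G s x" "reaches G s x'"
  shows "(\<exists>w. x' = x @ w) \<or> (\<exists>w. x = x' @ w)"
  using assms
proof (induction x rule: rev_induct)
  case (snoc p x)
  have "(\<exists>w. x' = x @ w) \<or> (\<exists>w. x = x' @ w)"
    using snoc.IH reaches_appendD[OF snoc.prems(1)] snoc.prems(2) .
  then consider w where "x' = x @ w" | w where "x = x' @ w"
    by (elim disjE exE)
  then show ?case
  proof cases
    case 1
    show ?thesis
    proof (cases w)
      case (Cons q v)
      have q: "reaches G s (x @ [q])" using snoc.prems(2) 1 Cons reaches_appendD[of s "x @ [q]" v] by auto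
      have n: "nonterm G x"
        using q reaches_appendD[OF q] unfolding reaches_def nonterm_def by (elim conjE) (intro conjI exI)
      \<comment> \<open>The move of an active player is fixed by the strategy, that of an inactive
        player by having a single feasible action.\<close>
      have "p j = q j" for j
      proof (cases "active G j x")
        case True
        then have "s j (cell G j x) = Some (q j)" "s j (cell G j x) = Some (p j)"
          using q snoc.prems(1) unfolding reaches_def allows_snoc by simp_all
        then show ?thesis by simp
      next
        case False
        moreover have "p j \<in> act G j x" "q j \<in> act G j x"
          using q snoc.prems(1) hist_snoc_iff[OF n] unfolding reaches_def by auto
        ultimately show ?thesis using n unfolding active_def by blast
      qed
      then have "p = q" by auto
      then show ?thesis using 1 Cons by simp
    qed (use 1 in auto)
  qed auto
qed simp

lemma outcome_ex:
  assumes "s \<in> Prof G"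
  shows "\<exists>z. z \<in> terminal G \<and> reaches G s z"
proof -
  have "reaches G s []" unfolding reaches_def using Nil_hist by (simp add: allows_def)
  moreover have "\<forall>x. reaches G s x \<longrightarrow> length x < Suc (Max (length ` hist G))"
    using finite_hist unfolding reaches_def by (simp add: less_Suc_eq_le)
  ultimately have "\<exists>x. reaches G s x \<and> (\<forall>x'. reaches G s x' \<longrightarrow> length x' \<le> length x)"
    by (rule Lattices_Big.ex_has_greatest_nat)
  then obtain x where x: "reaches G s x" "\<And>x'. reaches G s x' \<Longrightarrow> length x' \<le> length x"
    by (elim exE conjE) simp
  \<comment> \<open>A reached history of maximal length is terminal: otherwise every player has a
    feasible move, prescribed if the player is active, and the path could be extended.\<close>
  have "x \<in> terminal G"
  proof (rule ccontr)
    assume "x \<notin> terminal G"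
    then have n: "nonterm G x" using x(1) unfolding terminal_def nonterm_def reaches_def by blast
    have reach: "allows G j (s j) x" "s j \<in> Strat G j" for j
      using x(1) assms unfolding reaches_def Prof_def by auto
    have "\<exists>a\<in>act G j x. active G j x \<longrightarrow> s j (cell G j x) = Some a" for j
    proof (cases "active G j x")
      case True
      then show ?thesis
        using Strat_action[OF reach(2) True reach(1)] by blast
    qed (use nonterm_act_nonempty[OF n] in auto)
    then obtain p where "\<And>j. p j \<in> act G j x \<and> (active G j x \<longrightarrow> s j (cell G j x) = Some (p j))"
      by metis
    then have "reaches G s (x @ [p])"
      using x(1) hist_snoc_iff[OF n] unfolding reaches_def allows_snoc by auto
    from x(2)[OF this] show False by simp
  qed
  then show ?thesis using x(1) by blast
qed

lemma outcome_unique: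
  assumes "z \<in> terminal G" "reaches G s z"
  shows "outcome G s = z"
proof -
  have *: "z' = z''" if "z' \<in> terminal G" "z'' \<in> hist G" "z'' = z' @ w" for z' z'' w
  proof (cases w)
    case (Cons p v)
    then have "z' @ [p] \<in> hist G" using that hist_appendD[of "z' @ [p]" v] by simp
    then show ?thesis using that(1) unfolding terminal_def by blast
  qed (use that in simp)
  show ?thesis unfolding outcome_def
  proof (rule the_equality)
    fix z' assume z': "z' \<in> terminal G \<and> reaches G s z'"
    then show "z' = z"
      using reaches_comparable[of s z z'] * assms unfolding reaches_def by metis
  qed (use assms in blast)
qed

lemma outcome_terminal: "s \<in> Prof G \<Longrightarrow> outcome G s \<in> terminal G"
  and outcome_reaches: "s \<in> Prof G \<Longrightarrow> reaches G s (outcome G s)"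
  using outcome_ex outcome_unique by metis+

section \<open>Information sets under perfect recall\<close>

lemma StratAt_iff:
  assumes "c \<in> info G i"
  shows "t \<in> StratAt G i c \<longleftrightarrow> t \<in> Strat G i \<and> (\<forall>x\<in>c. allows G i t x)"
proof
  assume "t \<in> StratAt G i c"
  then obtain s x where s: "t = s i" "s \<in> Prof G" "x \<in> c" "reaches G s x"
    unfolding StratAt_def by blast
  then have "allows G i t x" unfolding reaches_def by blast
  then show "t \<in> Strat G i \<and> (\<forall>x\<in>c. allows G i t x)"
    using s allows_mem[OF assms s(3)] unfolding Prof_def by blast
next
  assume t: "t \<in> Strat G i \<and> (\<forall>x\<in>c. allows G i t x)"
  obtain x where x: "x \<in> c" using info_nonempty[OF assms] by blast
  have xh: "x \<in> hist G" using mem_hist[OF assms x] .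
  obtain f where f: "f j \<in> Strat G j" "allows G j (f j) x" for j
    using Strat_allows_ex[OF xh] by metis
  have "f(i := t) \<in> Prof G" "reaches G (f(i := t)) x"
    using f t x xh unfolding Prof_def reaches_def by auto
  then show "t \<in> StratAt G i c" unfolding StratAt_def using x by (intro CollectI exI[of _ "f(i := t)"]) auto
qed

lemma StratAt_subset: "StratAt G i c \<subseteq> Strat G i"
  unfolding StratAt_def Prof_def by auto

lemma StratAt_nonempty:
  assumes "c \<in> info G i"
  shows "StratAt G i c \<noteq> {}"
proof -
  obtain x where x: "x \<in> c" using info_nonempty[OF assms] by blast
  obtain t where "t \<in> Strat G i" "allows G i t x"
    using Strat_allows_ex[OF mem_hist[OF assms x]] by blast
  then show ?thesis using StratAt_iff[OF assms] allows_mem[OF assms x] by blast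
qed

lemma OthAt_iff:
  assumes "c \<in> info G i"
  shows "y \<in> OthAt G i c \<longleftrightarrow> y \<in> Y i \<and> (\<exists>x\<in>c. \<forall>j. j \<noteq> i \<longrightarrow> allows G j (y j) x)"
proof
  assume "y \<in> OthAt G i c"
  then obtain s x where s: "y = restrict s (- {i})" "s \<in> Prof G" "x \<in> c" "reaches G s x"
    unfolding OthAt_def by blast
  then show "y \<in> Y i \<and> (\<exists>x\<in>c. \<forall>j. j \<noteq> i \<longrightarrow> allows G j (y j) x)"
    unfolding Oth_def Prof_def reaches_def by auto
next
  assume y: "y \<in> Y i \<and> (\<exists>x\<in>c. \<forall>j. j \<noteq> i \<longrightarrow> allows G j (y j) x)"
  then obtain x where x: "x \<in> c" "\<forall>j. j \<noteq> i \<longrightarrow> allows G j (y j) x" by blast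
  have xh: "x \<in> hist G" using mem_hist[OF assms x(1)] .
  obtain t where t: "t \<in> Strat G i" "allows G i t x" using Strat_allows_ex[OF xh] by blast
  have "reaches G (y(i := t)) x" using x t xh unfolding reaches_def by auto
  moreover have "y = restrict (y(i := t)) (- {i})"
    using y unfolding Oth_def by (auto simp: fun_eq_iff PiE_iff extensional_def)
  ultimately show "y \<in> OthAt G i c"
    unfolding OthAt_def using Prof_upd[OF conjunct1[OF y] t(1)] x(1) by blast
qed

lemma OthAt_subset: "OthAt G i c \<subseteq> Y i"
  unfolding OthAt_def Oth_def Prof_def by (auto simp: restrict_PiE_iff split: if_splits)

lemma finite_OthAt: "finite (OthAt G i c)"
  using finite_subset[OF OthAt_subset finite_Oth] .

lemma OthAt_nonempty:
  assumes "c \<in> info G i"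
  shows "OthAt G i c \<noteq> {}"
proof -
  obtain t where "t \<in> StratAt G i c" using StratAt_nonempty[OF assms] by blast
  then show ?thesis unfolding StratAt_def OthAt_def by blast
qed

text \<open>By perfect recall the profiles reaching \<open>c\<close> form a product:
  \<open>t\<close> allows every member of \<open>c\<close>, so it can be combined with whichever
  member the opponents allow.\<close>

lemma reaches_info:
  assumes "c \<in> info G i" "t \<in> StratAt G i c" "y \<in> OthAt G i c"
  shows "\<exists>x\<in>c. reaches G (y(i := t)) x"
  using assms(2,3) mem_hist[OF assms(1)]
  unfolding StratAt_iff[OF assms(1)] OthAt_iff[OF assms(1)] reaches_def by fastforce

lemma mem_OthAt:
  assumes "c \<in> info G i" "x \<in> c" "reaches G (y(i := t)) x" "y \<in> Y i"
  shows "y \<in> OthAt G i c"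
  unfolding OthAt_iff[OF assms(1)]
proof (intro conjI bexI[OF _ assms(2)] allI impI)
  fix j assume "j \<noteq> i"
  then show "allows G j (y j) x" using assms(3) unfolding reaches_def by (auto dest: spec[of _ j])
qed (rule assms(4))

section \<open>Precedence and depth of information sets\<close>

definition prec :: "'i \<Rightarrow> ('i, 'a) hist set \<Rightarrow> ('i, 'a) hist set \<Rightarrow> bool" where
  "prec i c h \<longleftrightarrow> c = h \<or> (\<exists>x\<in>h. c \<in> fst ` set (experience G i x))"

definition depth :: "'i \<Rightarrow> ('i, 'a) hist set \<Rightarrow> nat" where
  "depth i c = length (experience G i (SOME x. x \<in> c))"

lemma depth_eq: "c \<in> info G i \<Longrightarrow> x \<in> c \<Longrightarrow> depth i c = length (experience G i x)"
  unfolding depth_def using perfect_recall someI[of "\<lambda>x. x \<in> c" x] by metis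

lemma prec_refl: "prec i c c"
  unfolding prec_def by simp

lemma experience_prefix:
  assumes "x \<in> hist G" "c \<in> fst ` set (experience G i x)"
  obtains k where "k < length x" "take k x \<in> c" "c \<in> info G i"
proof -
  obtain a where "(c, a) \<in> set (experience G i x)" using assms(2) by auto
  then show thesis using experience_split[OF _ assms(1)] that by metis
qed

text \<open>\<open>prec\<close> only asks that some history of \<open>h\<close> has passed through
  \<open>c\<close>; perfect recall extends this to every history of \<open>h\<close>. Transitivity
  and the monotonicity of \<open>StratAt\<close> and \<open>OthAt\<close> rest on this.\<close>

lemma prec_prefix:
  assumes "prec i c h" "h \<in> info G i" "x \<in> h"
  obtains k where "take k x \<in> c"
proof (cases "c = h")
  case True
  then show ?thesis using that[of "length x"] assms(3) by simp
next
  case False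
  then obtain x' where "x' \<in> h" "c \<in> fst ` set (experience G i x')"
    using assms(1) unfolding prec_def by blast
  then have "c \<in> fst ` set (experience G i x)"
    using perfect_recall[OF assms(2)] assms(3) by metis
  then show ?thesis using experience_prefix[OF mem_hist[OF assms(2,3)]] that by metis
qed

lemma prefix_prec:
  assumes "c \<in> info G i" "h \<in> info G i" "x @ w \<in> h" "x \<in> c"
  shows "prec i c h"
proof (cases w)
  case Nil
  then show ?thesis using info_disjoint[OF assms(1,2,4)] assms(3) prec_refl by simp
next
  case (Cons p v)
  then have "c \<in> fst ` set (experience G i (x @ w))"
    using experience_append_active[of i x w] active_mem[OF assms(1,4)] cell_eq[OF assms(1,4)] by auto
  then show ?thesis using assms(3) unfolding prec_def by blast
qed

lemma prec_depth:
  assumes "prec i c h" "c \<in> info G i" "h \<in> info G i" "c \<noteq> h"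
  shows "depth i c < depth i h"
proof -
  obtain x where x: "x \<in> h" using info_nonempty[OF assms(3)] by blast
  obtain k where k: "take k x \<in> c" using prec_prefix[OF assms(1,3) x] .
  have "drop k x \<noteq> []"
    using k x info_disjoint[OF assms(2,3)] assms(4) append_take_drop_id[of k x] by fastforce
  then show ?thesis
    using experience_append_active[OF active_mem[OF assms(2) k], of "drop k x"]
    unfolding depth_eq[OF assms(2) k] depth_eq[OF assms(3) x] by auto
qed

lemma prec_trans:
  assumes "prec i c d" "prec i d h" "c \<in> info G i" "d \<in> info G i" "h \<in> info G i"
  shows "prec i c h"
proof -
  obtain x where x: "x \<in> h" using info_nonempty[OF assms(5)] by blast
  obtain k where k: "take k x \<in> d" using prec_prefix[OF assms(2,5) x] .
  obtain l where l: "take l (take k x) \<in> c" using prec_prefix[OF assms(1,4) k] .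
  then have "take (min l k) x \<in> c" by simp
  then show ?thesis
    using prefix_prec[OF assms(3,5), of "take (min l k) x" "drop (min l k) x"] x by simp
qed

lemma StratAt_prec:
  assumes "prec i c h" "c \<in> info G i" "h \<in> info G i"
  shows "StratAt G i h \<subseteq> StratAt G i c"
proof
  fix t assume t: "t \<in> StratAt G i h"
  obtain x where x: "x \<in> h" using info_nonempty[OF assms(3)] by blast
  obtain k where k: "take k x \<in> c" using prec_prefix[OF assms(1,3) x] .
  have "allows G i t (take k x)" using t x allows_take unfolding StratAt_iff[OF assms(3)] by blast
  then show "t \<in> StratAt G i c"
    using allows_mem[OF assms(2) k] t unfolding StratAt_iff[OF assms(2)] StratAt_iff[OF assms(3)] by blast
qed

lemma OthAt_prec:
  assumes "prec i c h" "c \<in> info G i" "h \<in> info G i"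
  shows "OthAt G i h \<subseteq> OthAt G i c"
proof
  fix y assume y: "y \<in> OthAt G i h"
  then obtain x where x: "x \<in> h" "\<forall>j. j \<noteq> i \<longrightarrow> allows G j (y j) x"
    unfolding OthAt_iff[OF assms(3)] by blast
  obtain k where k: "take k x \<in> c" using prec_prefix[OF assms(1,3) x(1)] .
  show "y \<in> OthAt G i c"
    using y x k allows_take unfolding OthAt_iff[OF assms(2)] OthAt_iff[OF assms(3)] by blast
qed

text \<open>The profile \<open>y(i := t)\<close> meets both information sets, and the histories it
  reaches are nested. So one set precedes the other, and depth tells which.\<close>

lemma info_comparable:
  assumes "c \<in> info G i" "h \<in> info G i" "t \<in> StratAt G i c" "t \<in> StratAt G i h"
    and "y \<in> OthAt G i c" "y \<in> OthAt G i h" "depth i c \<le> depth i h"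
  shows "prec i c h"
proof -
  obtain x where x: "x \<in> c" "reaches G (y(i := t)) x" using reaches_info assms by blast
  obtain x' where x': "x' \<in> h" "reaches G (y(i := t)) x'" using reaches_info assms by blast
  from reaches_comparable[OF x(2) x'(2)] show ?thesis
  proof (elim disjE exE)
    fix w assume "x' = x @ w"
    then show ?thesis using prefix_prec[OF assms(1,2)] x x' by blast
  next
    fix w assume "x = x' @ w"
    then have "prec i h c" using prefix_prec[OF assms(2,1)] x x' by blast
    then show ?thesis using prec_depth[of i h c] assms prec_refl by fastforce
  qed
qed

text \<open>Perfect recall makes it possible to switch from s to t exactly at the
  information sets that weakly follow c.\<close>

lemma allows_splice:
  assumes c: "c \<in> info G i" and s: "s \<in> StratAt G i c" and t: "t \<in> StratAt G i c"
  obtains r where "r \<in> Strat G i"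
    and "\<And>x. x \<in> hist G \<Longrightarrow> c \<in> fst ` set (experience G i x) \<Longrightarrow> allows G i r x \<longleftrightarrow> allows G i t x"
    and "\<And>x. x \<in> hist G \<Longrightarrow> c \<notin> fst ` set (experience G i x) \<Longrightarrow> allows G i r x \<longleftrightarrow> allows G i s x"
proof -
  obtain \<sigma> where \<sigma>: "\<sigma> \<in> std_strat G i" "s = reduce G i \<sigma>"
    using s StratAt_subset unfolding Strat_def by blast
  obtain \<tau> where \<tau>: "\<tau> \<in> std_strat G i" "t = reduce G i \<tau>"
    using t StratAt_subset unfolding Strat_def by blast
  define \<rho> where "\<rho> = (\<lambda>d. if prec i c d then \<tau> d else \<sigma> d)"
  have "\<rho> \<in> std_strat G i" using \<sigma>(1) \<tau>(1) unfolding \<rho>_def std_strat_def by auto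
  then have r: "reduce G i \<rho> \<in> Strat G i" unfolding Strat_def by blast
  have al: "allows G i (Some \<circ> \<sigma>) x" "allows G i (Some \<circ> \<tau>) x" if "x \<in> c" for x
    using s t \<sigma>(2) \<tau>(2) that allows_reduce[OF mem_hist[OF c that]] unfolding StratAt_iff[OF c] by auto
  have 1: "\<rho> d = \<tau> d" if x: "x \<in> hist G" "c \<in> fst ` set (experience G i x)"
    and d: "(d, a) \<in> set (experience G i x)" for x d a
  proof -
    obtain k where k: "k < length x" "take k x \<in> c" using experience_prefix[OF x] .
    obtain l where l: "l < length x" "take l x \<in> d" "d \<in> info G i" "cell G i (take l x) = d" "a = (x ! l) i"
      using experience_split[OF d x(1)] .
    show ?thesis
    proof (cases "k \<le> l")
      case True
      then have "take l x = take k x @ take (l - k) (drop k x)" by (simp add: take_add[symmetric])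
      then have "prec i c d" using prefix_prec[OF c l(3) _ k(2)] l(2) by metis
      then show ?thesis unfolding \<rho>_def by simp
    next
      case False
      then have "active G i (take l (take k x))" "l < length (take k x)" "take l (take k x) = take l x"
        using l k active_mem by (auto simp: min_def)
      then have "(cell G i (take l x), (take k x ! l) i) \<in> set (experience G i (take k x))"
        unfolding set_experience by force
      \<comment> \<open>Cells met before \<open>c\<close> need no switch: both strategies allow the
        prefix in \<open>c\<close>, so their choices there agree.\<close>
      then have "\<sigma> d = \<tau> d" using al[OF k(2)] l(4) unfolding allows_iff by force
      then show ?thesis unfolding \<rho>_def by simp
    qed
  qed
  have 2: "\<rho> d = \<sigma> d" if x: "x \<in> hist G" "c \<notin> fst ` set (experience G i x)"
    and d: "(d, a) \<in> set (experience G i x)" for x d a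
  proof -
    obtain l where l: "l < length x" "take l x \<in> d" "d \<in> info G i" "cell G i (take l x) = d" "a = (x ! l) i"
      using experience_split[OF d x(1)] .
    have "\<not> prec i c d"
    proof
      assume "prec i c d"
      from prec_prefix[OF this l(3,2)] obtain k where "take k (take l x) \<in> c" .
      then have m: "take (min k l) x \<in> c" by simp
      have "drop (min k l) x \<noteq> []" using l(1) by simp
      from experience_append_active[OF active_mem[OF c m] this] cell_eq[OF c m] x(2)
      show False by auto
    qed
    then show ?thesis unfolding \<rho>_def by simp
  qed
  show thesis
  proof
    fix x assume x: "x \<in> hist G"
    show "allows G i (reduce G i \<rho>) x \<longleftrightarrow> allows G i t x" if "c \<in> fst ` set (experience G i x)"
      using 1[OF x that] unfolding \<tau>(2) allows_reduce[OF x] unfolding allows_iff by fastforce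
    show "allows G i (reduce G i \<rho>) x \<longleftrightarrow> allows G i s x" if "c \<notin> fst ` set (experience G i x)"
      using 2[OF x that] unfolding \<sigma>(2) allows_reduce[OF x] unfolding allows_iff by fastforce
  qed (rule r)
qed

text \<open>Since \<open>s\<close> and \<open>t\<close> both reach \<open>c\<close>, play against
  \<open>y\<close> passes through \<open>c\<close> exactly when \<open>y\<close> lies in
  \<open>OthAt G i c\<close>. Switching at \<open>c\<close> thus gives the outcome of
  \<open>t\<close> against these opponents and that of \<open>s\<close> against all others.\<close>

lemma splice:
  assumes c: "c \<in> info G i" and s: "s \<in> StratAt G i c" and t: "t \<in> StratAt G i c"
  obtains r where "r \<in> StratAt G i c"
    and "\<And>y. y \<in> OthAt G i c \<Longrightarrow> outcome G (y(i := r)) = outcome G (y(i := t))"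
    and "\<And>y. y \<in> Y i \<Longrightarrow> y \<notin> OthAt G i c \<Longrightarrow> outcome G (y(i := r)) = outcome G (y(i := s))"
    and "\<And>h. h \<in> info G i \<Longrightarrow> \<not> prec i c h \<Longrightarrow> r \<in> StratAt G i h \<longleftrightarrow> s \<in> StratAt G i h"
proof -
  obtain r where r: "r \<in> Strat G i"
    and rt: "\<And>x. x \<in> hist G \<Longrightarrow> c \<in> fst ` set (experience G i x) \<Longrightarrow> allows G i r x \<longleftrightarrow> allows G i t x"
    and rs: "\<And>x. x \<in> hist G \<Longrightarrow> c \<notin> fst ` set (experience G i x) \<Longrightarrow> allows G i r x \<longleftrightarrow> allows G i s x"
    using allows_splice[OF assms] by blast
  have sS: "s \<in> Strat G i" and tS: "t \<in> Strat G i" using s t StratAt_subset by auto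
  have upd: "reaches G (y(i := f)) x \<longleftrightarrow> reaches G (y(i := g)) x"
    if "allows G i f x \<longleftrightarrow> allows G i g x" for y f g x
    using that unfolding reaches_def by (metis fun_upd_apply)
  have rc: "r \<in> StratAt G i c"
    using s r rs mem_hist[OF c] experience_no_repeat[OF c] unfolding StratAt_iff[OF c] by blast
  show thesis
  proof
    show "r \<in> StratAt G i c" by (rule rc)
  next
    fix y assume y: "y \<in> OthAt G i c"
    let ?z = "outcome G (y(i := t))"
    have p: "y(i := t) \<in> Prof G" using Prof_upd y OthAt_subset tS by blast
    have z: "?z \<in> terminal G" "reaches G (y(i := t)) ?z"
      using outcome_terminal[OF p] outcome_reaches[OF p] .
    obtain x where x: "x \<in> c" "reaches G (y(i := t)) x" using reaches_info[OF c t y] by blast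
    have n: "nonterm G x" using active_mem[OF c x(1)] unfolding active_def by blast
    \<comment> \<open>\<open>w\<close> has to be nonempty, because an experience lists
      \<open>c\<close> only after a move has been made there.\<close>
    from reaches_comparable[OF x(2) z(2)] obtain w where w: "?z = x @ w" "w \<noteq> []"
    proof (elim disjE exE)
      fix w assume "x = ?z @ w"
      then have "w = [] \<or> (\<exists>p v. x = ?z @ [p] @ v)" by (cases w) auto
      moreover have False if "x = ?z @ [p] @ v" for p v
      proof -
        have "?z @ [p] \<in> hist G" using hist_appendD[of "?z @ [p]" v] mem_hist[OF c x(1)] that by simp
        then show False using z(1) unfolding terminal_def by blast
      qed
      ultimately have "x = ?z" using \<open>x = ?z @ w\<close> by auto
      then show thesis using n z(1) unfolding terminal_def nonterm_def by auto
    next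
      fix w assume "?z = x @ w"
      then show thesis using that n z(1) unfolding terminal_def nonterm_def by (cases w) auto
    qed
    have "c \<in> fst ` set (experience G i ?z)"
      using experience_append_active[OF active_mem[OF c x(1)] w(2)] w(1) cell_eq[OF c x(1)] by auto
    moreover have "?z \<in> hist G" using z(1) unfolding terminal_def by blast
    ultimately have "reaches G (y(i := r)) ?z" using upd[OF rt] z(2) by blast
    then show "outcome G (y(i := r)) = ?z" using outcome_unique z(1) by blast
  next
    fix y assume y: "y \<in> Y i" "y \<notin> OthAt G i c"
    let ?z = "outcome G (y(i := s))"
    have p: "y(i := s) \<in> Prof G" using Prof_upd y sS by blast
    have z: "?z \<in> terminal G" "reaches G (y(i := s)) ?z"
      using outcome_terminal[OF p] outcome_reaches[OF p] .
    have zh: "?z \<in> hist G" using z(1) unfolding terminal_def by blast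
    have "c \<notin> fst ` set (experience G i ?z)"
    proof
      assume "c \<in> fst ` set (experience G i ?z)"
      then obtain k where "take k ?z \<in> c" using experience_prefix[OF zh] by blast
      moreover have "reaches G (y(i := s)) (take k ?z)"
        using reaches_appendD[of _ "take k ?z" "drop k ?z"] z(2) by simp
      ultimately show False using mem_OthAt[OF c] y by blast
    qed
    then have "reaches G (y(i := r)) ?z" using upd[OF rs[OF zh]] z(2) by blast
    then show "outcome G (y(i := r)) = ?z" using outcome_unique z(1) by blast
  next
    fix h assume h: "h \<in> info G i" "\<not> prec i c h"
    then have "c \<notin> fst ` set (experience G i x)" if "x \<in> h" for x using that unfolding prec_def by blast
    then show "r \<in> StratAt G i h \<longleftrightarrow> s \<in> StratAt G i h"
      using rs mem_hist[OF h(1)] r sS unfolding StratAt_iff[OF h(1)] by blast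
  qed
qed

section \<open>Conditional probability systems and sequential best replies\<close>

lemma cps_nonneg: "cps G i \<mu> \<Longrightarrow> c \<in> info G i \<Longrightarrow> 0 \<le> \<mu> (OthAt G i c) y"
  and cps_sum: "cps G i \<mu> \<Longrightarrow> c \<in> info G i \<Longrightarrow> sum (\<mu> (OthAt G i c)) (OthAt G i c) = 1"
  unfolding cps_def by auto

lemma cps_zero:
  assumes "cps G i \<mu>" "c \<in> info G i" "y \<notin> OthAt G i c"
  shows "\<mu> (OthAt G i c) y = 0"
proof (cases "y \<in> Y i")
  case True
  let ?w = "\<mu> (OthAt G i c)"
  have "sum ?w (Y i) = 1" "sum ?w (OthAt G i c) = 1" using assms(1,2) unfolding cps_def by auto
  moreover have "sum ?w (Y i - OthAt G i c) = sum ?w (Y i) - sum ?w (OthAt G i c)"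
    by (rule sum_diff[OF finite_Oth OthAt_subset])
  ultimately have "sum ?w (Y i - OthAt G i c) = 0" by simp
  moreover have "finite (Y i - OthAt G i c)" using finite_Oth by blast
  ultimately have "\<forall>y\<in>Y i - OthAt G i c. ?w y = 0"
    using sum_nonneg_eq_0_iff[of "Y i - OthAt G i c" ?w] cps_nonneg[OF assms(1,2)] by simp
  then show ?thesis using True assms(3) by blast
next
  case False
  then show ?thesis using assms unfolding cps_def by auto
qed

lemma cps_chain:
  assumes "cps G i \<mu>" "c \<in> info G i" "h \<in> info G i" "OthAt G i h \<subseteq> OthAt G i c" "y \<in> OthAt G i h"
  shows "\<mu> (OthAt G i c) y = \<mu> (OthAt G i h) y * sum (\<mu> (OthAt G i c)) (OthAt G i h)"
proof -
  have "sum (\<mu> (OthAt G i c)) {y} = sum (\<mu> (OthAt G i h)) {y} * sum (\<mu> (OthAt G i c)) (OthAt G i h)"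
    using assms unfolding cps_def by blast
  then show ?thesis by simp
qed

text \<open>Both sides of the chain rule are additive in the event \<open>A\<close>, so it is enough
  to verify it point by point.\<close>

lemma cpsI:
  assumes nonneg: "\<And>c y. c \<in> info G i \<Longrightarrow> 0 \<le> \<mu> (OthAt G i c) y"
    and zero: "\<And>c y. c \<in> info G i \<Longrightarrow> y \<notin> OthAt G i c \<Longrightarrow> \<mu> (OthAt G i c) y = 0"
    and sum: "\<And>c. c \<in> info G i \<Longrightarrow> sum (\<mu> (OthAt G i c)) (OthAt G i c) = 1"
    and chain: "\<And>c h y. c \<in> info G i \<Longrightarrow> h \<in> info G i \<Longrightarrow> OthAt G i h \<subseteq> OthAt G i c \<Longrightarrow>
      y \<in> OthAt G i h \<Longrightarrow> \<mu> (OthAt G i c) y = \<mu> (OthAt G i h) y * sum (\<mu> (OthAt G i c)) (OthAt G i h)"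
  shows "cps G i \<mu>"
  unfolding cps_def
proof (intro conjI ballI allI impI)
  fix E assume "E \<in> OthAt G i ` info G i"
  then obtain c where c: "c \<in> info G i" "E = OthAt G i c" by blast
  show "0 \<le> \<mu> E x" for x using nonneg c by simp
  show "\<mu> E x = 0" if "x \<notin> Y i" for x using zero[OF c(1)] c(2) that OthAt_subset by blast
  show s: "sum (\<mu> E) E = 1" using sum c by simp
  have "sum (\<mu> E) (Y i) = sum (\<mu> E) E"
    unfolding c(2) using zero[OF c(1)] by (intro sum.mono_neutral_right finite_Oth OthAt_subset) auto
  then show "sum (\<mu> E) (Y i) = 1" using s by simp
next
  fix A E E' assume "E \<in> OthAt G i ` info G i" "E' \<in> OthAt G i ` info G i" and A: "A \<subseteq> E'" "E' \<subseteq> E"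
  then obtain c h where c: "c \<in> info G i" "E = OthAt G i c" "h \<in> info G i" "E' = OthAt G i h" by auto
  have "\<mu> E y = \<mu> E' y * sum (\<mu> E) E'" if "y \<in> A" for y
    using chain[OF c(1,3)] A that unfolding c(2,4) by blast
  then show "sum (\<mu> E) A = sum (\<mu> E') A * sum (\<mu> E) E'"
    unfolding sum_distrib_right by (rule sum.cong[OF refl])
qed

lemma glue_cps:
  assumes cps: "cps G i \<mu>" and w: "\<forall>y. 0 \<le> w y"
  shows "cps G i (glue w \<mu>)"
proof (rule cpsI)
  fix c assume c: "c \<in> info G i"
  show "0 \<le> glue w \<mu> (OthAt G i c) y" for y
    using w cps_nonneg[OF cps c] by (auto simp: glue_def condition_def)
  show "glue w \<mu> (OthAt G i c) y = 0" if "y \<notin> OthAt G i c" for y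
    using cps_zero[OF cps c] that by (auto simp: glue_def condition_def)
  show "sum (glue w \<mu> (OthAt G i c)) (OthAt G i c) = 1"
    using cps_sum[OF cps c] by (auto simp: glue_def condition_def sum_divide_distrib[symmetric])
next
  fix c h y assume c: "c \<in> info G i" "h \<in> info G i" "OthAt G i h \<subseteq> OthAt G i c" "y \<in> OthAt G i h"
  let ?E = "OthAt G i c" and ?F = "OthAt G i h"
  have le: "sum w ?F \<le> sum w ?E" using w by (intro sum_mono2 finite_OthAt c(3)) auto
  have 0: "0 \<le> sum w ?F" using w by (simp add: sum_nonneg)
  have sF: "sum (condition w ?E) ?F = sum w ?F / sum w ?E"
    unfolding condition_def sum_divide_distrib using c(3) by (intro sum.cong) auto
  \<comment> \<open>If \<open>?E\<close> is uncharged, so is \<open>?F\<close>, and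
    \<open>\<mu>\<close> decides both; if both are charged, the normalising constants cancel; if
    only \<open>?E\<close> is charged, \<open>w\<close> vanishes on \<open>?F\<close> and both sides
    are 0.\<close>
  consider "\<not> sum w ?E > 0" | "sum w ?E > 0" "sum w ?F > 0" | "sum w ?E > 0" "sum w ?F = 0"
    using 0 by linarith
  then show "glue w \<mu> ?E y = glue w \<mu> ?F y * sum (glue w \<mu> ?E) ?F"
  proof cases
    case 1
    then show ?thesis using le cps_chain[OF cps c] by (simp add: glue_def)
  next
    case 2
    then show ?thesis using c sF by (auto simp: glue_def condition_def)
  next
    case 3
    then have "w y = 0" using w c(4) by (simp add: sum_nonneg_eq_0_iff finite_OthAt)
    then show ?thesis using 3 sF by (simp add: glue_def condition_def)
  qed
qed

lemma lex_cps_cps: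
  "cps G i \<mu> \<Longrightarrow> \<forall>w\<in>set L. \<forall>y. 0 \<le> w y \<Longrightarrow> cps G i (lex_cps L \<mu>)"
  by (induction L) (auto intro: glue_cps)

lemma ex_cps: "\<exists>\<mu>. cps G i \<mu>"
proof -
  let ?m = "condition (\<lambda>_. 1) :: ('i \<Rightarrow> ('i, 'a) strat) set \<Rightarrow> _"
  have pos: "card (OthAt G i c) \<noteq> 0" if "c \<in> info G i" for c
    using OthAt_nonempty[OF that] finite_OthAt by simp
  have "cps G i ?m"
  proof (rule cpsI)
    fix c assume c: "c \<in> info G i"
    show "0 \<le> ?m (OthAt G i c) y" for y by (simp add: condition_def)
    show "?m (OthAt G i c) y = 0" if "y \<notin> OthAt G i c" for y using that by (simp add: condition_def)
    show "sum (?m (OthAt G i c)) (OthAt G i c) = 1" using pos[OF c] by (simp add: condition_def)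
  next
    fix c h y assume c: "c \<in> info G i" "h \<in> info G i" "OthAt G i h \<subseteq> OthAt G i c" "y \<in> OthAt G i h"
    have "sum (?m (OthAt G i c)) (OthAt G i h) = card (OthAt G i h) / card (OthAt G i c)"
      using c(3) by (simp add: condition_def subset_iff)
    then show "?m (OthAt G i c) y = ?m (OthAt G i h) y * sum (?m (OthAt G i c)) (OthAt G i h)"
      using c pos[OF c(2)] by (auto simp: condition_def)
  qed
  then show ?thesis by blast
qed

text \<open>Formulated as vanishing outside \<open>B\<close> rather than as probability one, so that
  it also applies to systems that are not normalised, such as the zero system. It looks at the
  opponents alone and thus implies the requirement in \<open>cps_on\<close>, which also asks that
  the player's own strategies reach \<open>c\<close>.\<close>

definition strong_belief ::
  "'i \<Rightarrow> (('i \<Rightarrow> ('i, 'a) strat) set \<Rightarrow> ('i \<Rightarrow> ('i, 'a) strat) \<Rightarrow> real) \<Rightarrow> ('i \<Rightarrow> ('i, 'a) strat) set \<Rightarrow> bool" where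
  "strong_belief i \<mu> B \<longleftrightarrow> (\<forall>c\<in>info G i. B \<inter> OthAt G i c \<noteq> {} \<longrightarrow>
     (\<forall>y. y \<notin> B \<longrightarrow> \<mu> (OthAt G i c) y = 0))"

lemma strong_belief_sum:
  assumes "strong_belief i \<mu> B" "cps G i \<mu>" "c \<in> info G i" "B \<inter> OthAt G i c \<noteq> {}"
  shows "sum (\<mu> (OthAt G i c)) (B \<inter> OthAt G i c) = 1"
proof -
  have "sum (\<mu> (OthAt G i c)) (B \<inter> OthAt G i c) = sum (\<mu> (OthAt G i c)) (OthAt G i c)"
    using assms unfolding strong_belief_def by (intro sum.mono_neutral_left finite_OthAt) auto
  then show ?thesis using cps_sum[OF assms(2,3)] by simp
qed

lemma strong_belief_lex:
  assumes "strong_belief i \<mu> B" "\<forall>w\<in>set L. \<forall>y. y \<notin> B \<longrightarrow> w y = 0"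
  shows "strong_belief i (lex_cps L \<mu>) B"
  using assms(2)
proof (induction L)
  case (Cons w L)
  then show ?case unfolding strong_belief_def by (auto simp: glue_def condition_def)
qed (simp add: assms(1))

section \<open>Expected values, deviations and dynamic consistency\<close>

definition ev ::
  "'i \<Rightarrow> (('i, 'a) hist \<Rightarrow> real) \<Rightarrow> (('i \<Rightarrow> ('i, 'a) strat) \<Rightarrow> real) \<Rightarrow> ('i, 'a) strat \<Rightarrow> real" where
  "ev i v w t = (\<Sum>y\<in>Y i. v (outcome G (y(i := t))) * w y)"

lemma ev_restrict:
  assumes "\<And>y. y \<notin> E \<Longrightarrow> w y = 0" "E \<subseteq> Y i"
  shows "ev i v w t = (\<Sum>y\<in>E. v (outcome G (y(i := t))) * w y)"
  unfolding ev_def using assms by (intro sum.mono_neutral_right finite_Oth) auto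

definition best_at ::
  "'i \<Rightarrow> (('i, 'a) hist \<Rightarrow> real) \<Rightarrow> (('i \<Rightarrow> ('i, 'a) strat) \<Rightarrow> real) \<Rightarrow> ('i, 'a) hist set \<Rightarrow> ('i, 'a) strat \<Rightarrow> bool" where
  "best_at i v w c s \<longleftrightarrow> (\<forall>t\<in>StratAt G i c. ev i v w t \<le> ev i v w s)"

lemma ex_best_at:
  assumes "c \<in> info G i"
  shows "\<exists>t\<in>StratAt G i c. best_at i v w c t"
proof -
  have "finite (StratAt G i c)" using finite_subset[OF StratAt_subset finite_Strat] .
  from arg_min_if_finite[OF this StratAt_nonempty[OF assms], of "\<lambda>t. - ev i v w t"]
  show ?thesis unfolding best_at_def
    by (intro bexI[of _ "arg_min_on (\<lambda>t. - ev i v w t) (StratAt G i c)"]) (auto simp: not_less)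
qed

text \<open>What remains of a splice once the inserted strategy is forgotten. In this form the
  property persists when a further deviation is made at a set following \<open>c\<close>.\<close>

definition deviation :: "'i \<Rightarrow> ('i, 'a) hist set \<Rightarrow> ('i, 'a) strat \<Rightarrow> ('i, 'a) strat \<Rightarrow> bool" where
  "deviation i c s r \<longleftrightarrow> r \<in> StratAt G i c \<and>
     (\<forall>y\<in>Y i - OthAt G i c. outcome G (y(i := r)) = outcome G (y(i := s))) \<and>
     (\<forall>h\<in>info G i. \<not> prec i c h \<longrightarrow> (r \<in> StratAt G i h \<longleftrightarrow> s \<in> StratAt G i h))"

lemma deviation_ex:
  assumes "c \<in> info G i" "s \<in> StratAt G i c" "t \<in> StratAt G i c"
  shows "\<exists>r. deviation i c s r \<and> (\<forall>y\<in>OthAt G i c. outcome G (y(i := r)) = outcome G (y(i := t)))"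
proof -
  obtain r where "r \<in> StratAt G i c"
    and "\<And>y. y \<in> OthAt G i c \<Longrightarrow> outcome G (y(i := r)) = outcome G (y(i := t))"
    and "\<And>y. y \<in> Y i \<Longrightarrow> y \<notin> OthAt G i c \<Longrightarrow> outcome G (y(i := r)) = outcome G (y(i := s))"
    and "\<And>h. h \<in> info G i \<Longrightarrow> \<not> prec i c h \<Longrightarrow> r \<in> StratAt G i h \<longleftrightarrow> s \<in> StratAt G i h"
    using splice[OF assms] by metis
  then show ?thesis unfolding deviation_def by (intro exI[of _ r]) auto
qed

lemma deviation_ev:
  assumes "deviation i c s r" "\<And>y. y \<in> OthAt G i c \<Longrightarrow> outcome G (y(i := r)) = outcome G (y(i := t))"
  shows "ev i v w r = ev i v w s +
    (\<Sum>y\<in>OthAt G i c. (v (outcome G (y(i := t))) - v (outcome G (y(i := s)))) * w y)"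
proof -
  have "ev i v w r - ev i v w s =
      (\<Sum>y\<in>Y i. (v (outcome G (y(i := r))) - v (outcome G (y(i := s)))) * w y)"
    unfolding ev_def by (simp add: sum_subtractf[symmetric] left_diff_distrib)
  also have "\<dots> = (\<Sum>y\<in>OthAt G i c. (v (outcome G (y(i := r))) - v (outcome G (y(i := s)))) * w y)"
    using assms(1) unfolding deviation_def
    by (intro sum.mono_neutral_right finite_Oth OthAt_subset) auto
  also have "\<dots> = (\<Sum>y\<in>OthAt G i c. (v (outcome G (y(i := t))) - v (outcome G (y(i := s)))) * w y)"
    using assms(2) by (intro sum.cong) auto
  finally show ?thesis by simp
qed

lemma deviation_ev_eq:
  assumes "deviation i c s r" "\<And>y. y \<in> OthAt G i c \<Longrightarrow> w y = 0"
  shows "ev i v w r = ev i v w s"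
  using deviation_ev[OF assms(1), of r v w] assms(2) by simp

text \<open>Bayesian updating preserves optimality: a better continuation at \<open>h\<close> could
  be spliced into \<open>s\<close> and would beat it at \<open>c\<close>. The spliced strategy need
  not be a survivor, so optimality among all strategies is essential.\<close>

lemma best_at_condition:
  assumes c: "c \<in> info G i" and h: "h \<in> info G i" and ch: "prec i c h" and s: "s \<in> StratAt G i h"
    and best: "best_at i v w c s" and pos: "sum w (OthAt G i h) > 0"
  shows "best_at i v (condition w (OthAt G i h)) h s"
  unfolding best_at_def
proof
  fix t assume t: "t \<in> StratAt G i h"
  let ?F = "OthAt G i h"
  obtain r where r: "deviation i h s r"
    "\<And>y. y \<in> ?F \<Longrightarrow> outcome G (y(i := r)) = outcome G (y(i := t))"
    using deviation_ex[OF h s t] by blast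
  have "r \<in> StratAt G i c" using r(1) StratAt_prec[OF ch c h] unfolding deviation_def by blast
  then have "ev i v w r \<le> ev i v w s" using best unfolding best_at_def by blast
  then have "(\<Sum>y\<in>?F. (v (outcome G (y(i := t))) - v (outcome G (y(i := s)))) * w y) \<le> 0"
    using deviation_ev[OF r] by simp
  then have "(\<Sum>y\<in>?F. v (outcome G (y(i := t))) * w y) \<le> (\<Sum>y\<in>?F. v (outcome G (y(i := s))) * w y)"
    by (simp add: left_diff_distrib sum_subtractf)
  moreover have "ev i v (condition w ?F) f = (\<Sum>y\<in>?F. v (outcome G (y(i := f))) * w y) / sum w ?F" for f
    by (subst ev_restrict[of ?F]) (auto simp: condition_def OthAt_subset[THEN subsetD] sum_divide_distrib)
  ultimately show "ev i v (condition w ?F) t \<le> ev i v (condition w ?F) s"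
    using pos by (simp add: divide_right_mono)
qed

text \<open>Information sets are optimized in order of depth. A later improvement at h changes the
  value at an earlier h' only by the mass of h times a nonnegative amount, so it preserves
  optimality at h'.\<close>

lemma best_reply_from:
  assumes cps: "cps G i \<mu>" and c: "c \<in> info G i" and s: "s \<in> StratAt G i c"
  shows "\<exists>r. deviation i c s r \<and>
    (\<forall>h\<in>info G i. prec i c h \<longrightarrow> r \<in> StratAt G i h \<longrightarrow> best_at i v (\<mu> (OthAt G i h)) h r)"
proof -
  let ?A = "{h \<in> info G i. prec i c h}"
  have "\<exists>r. deviation i c s r \<and>
    (\<forall>h\<in>?A. r \<in> StratAt G i h \<longrightarrow> best_at i v (\<mu> (OthAt G i h)) h r)"
  proof (induction rule: finite_ranked_induct[where A = ?A and f = "depth i"])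
    case 1
    show ?case using finite_info by simp
  next
    case 2
    have "deviation i c s s" using s unfolding deviation_def by blast
    then show ?case by blast
  next
    case (3 D h)
    then obtain r where r: "deviation i c s r"
      "\<And>d. d \<in> D \<Longrightarrow> r \<in> StratAt G i d \<Longrightarrow> best_at i v (\<mu> (OthAt G i d)) d r"
      by blast
    have h: "h \<in> info G i" "prec i c h" using 3(2) by auto
    show ?case
    proof (cases "r \<in> StratAt G i h")
      case False
      then show ?thesis using r by blast
    next
      case True
      let ?F = "OthAt G i h"
      obtain t where t: "t \<in> StratAt G i h" "best_at i v (\<mu> ?F) h t"
        using ex_best_at[OF h(1)] by blast
      obtain q where q: "deviation i h r q"
        "\<And>y. y \<in> ?F \<Longrightarrow> outcome G (y(i := q)) = outcome G (y(i := t))"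
        using deviation_ex[OF h(1) True t(1)] by blast
      have qh: "q \<in> StratAt G i h" using q(1) unfolding deviation_def by blast
      have FE: "?F \<subseteq> OthAt G i c" using OthAt_prec h c by blast
      have dev: "deviation i c s q"
        unfolding deviation_def
      proof (intro conjI ballI impI)
        show "q \<in> StratAt G i c" using qh StratAt_prec[OF h(2) c h(1)] by blast
        fix y assume y: "y \<in> Y i - OthAt G i c"
        then have "outcome G (y(i := q)) = outcome G (y(i := r))"
          using q(1) FE unfolding deviation_def by blast
        also have "\<dots> = outcome G (y(i := s))" using r(1) y unfolding deviation_def by blast
        finally show "outcome G (y(i := q)) = outcome G (y(i := s))" .
      next
        fix d assume d: "d \<in> info G i" "\<not> prec i c d"
        then have "\<not> prec i h d" using prec_trans[OF h(2) _ c h(1)] by blast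
        then show "q \<in> StratAt G i d \<longleftrightarrow> s \<in> StratAt G i d"
          using q(1) r(1) d unfolding deviation_def by blast
      qed
      have best_h: "best_at i v (\<mu> ?F) h q"
      proof -
        have "ev i v (\<mu> ?F) q = ev i v (\<mu> ?F) t"
          using q(2) by (simp add: ev_restrict[OF cps_zero[OF cps h(1)] OthAt_subset])
        then show ?thesis using t(2) unfolding best_at_def by simp
      qed
      have "best_at i v (\<mu> (OthAt G i d)) d q" if d: "d \<in> D" "q \<in> StratAt G i d" for d
      proof -
        let ?E = "OthAt G i d"
        have di: "d \<in> info G i" "d \<noteq> h" "depth i d \<le> depth i h" using 3 d(1) by auto
        \<comment> \<open>Sets treated before \<open>h\<close> do not follow it, so the deviation at
          \<open>h\<close> does not change which of them are reached.\<close>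
        then have "\<not> prec i h d" using prec_depth[OF _ h(1) di(1)] by fastforce
        then have rd: "r \<in> StratAt G i d" using q(1) d(2) di(1) unfolding deviation_def by blast
        have "ev i v (\<mu> ?E) r \<le> ev i v (\<mu> ?E) q"
        proof (cases "?E \<inter> ?F = {}")
          case True
          then have "ev i v (\<mu> ?E) q = ev i v (\<mu> ?E) r"
            using deviation_ev_eq[OF q(1)] cps_zero[OF cps di(1)] by blast
          then show ?thesis by simp
        next
          case False
          then have "prec i d h" using info_comparable[OF di(1) h(1) rd True] di(3) by blast
          then have sub: "?F \<subseteq> ?E" using OthAt_prec di(1) h(1) by blast
          have 1: "(\<Sum>y\<in>?F. (v (outcome G (y(i := t))) - v (outcome G (y(i := r)))) * \<mu> ?E y)
            = (\<Sum>y\<in>?F. (v (outcome G (y(i := t))) - v (outcome G (y(i := r)))) * \<mu> ?F y) * sum (\<mu> ?E) ?F"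
            unfolding sum_distrib_right
            using cps_chain[OF cps di(1) h(1) sub] by (intro sum.cong) auto
          have 2: "(\<Sum>y\<in>?F. (v (outcome G (y(i := t))) - v (outcome G (y(i := r)))) * \<mu> ?F y)
            = ev i v (\<mu> ?F) t - ev i v (\<mu> ?F) r"
            by (simp add: ev_restrict[OF cps_zero[OF cps h(1)] OthAt_subset] left_diff_distrib sum_subtractf)
          have "ev i v (\<mu> ?E) q = ev i v (\<mu> ?E) r
              + (ev i v (\<mu> ?F) t - ev i v (\<mu> ?F) r) * sum (\<mu> ?E) ?F"
            using deviation_ev[OF q, of v "\<mu> ?E"] unfolding 1 2 .
          moreover have "(ev i v (\<mu> ?F) t - ev i v (\<mu> ?F) r) * sum (\<mu> ?E) ?F \<ge> 0"
            using t(2) True cps_nonneg[OF cps di(1)] unfolding best_at_def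
            by (intro mult_nonneg_nonneg sum_nonneg) auto
          ultimately show ?thesis by linarith
        qed
        then show ?thesis using r(2)[OF d(1) rd] unfolding best_at_def by fastforce
      qed
      then show ?thesis using dev best_h by blast
    qed
  qed
  then show ?thesis by blast
qed

lemma ev_condition:
  assumes "\<And>y. y \<notin> E \<Longrightarrow> w y = 0"
  shows "ev i v (condition w E) t = ev i v w t / sum w E"
proof -
  have "condition w E = (\<lambda>y. w y / sum w E)" using assms by (auto simp: condition_def)
  then show ?thesis unfolding ev_def by (simp add: sum_divide_distrib)
qed

text \<open>The information sets of s that are consistent with RO are processed in order of depth,
  collecting weights on RO. If c is not yet charged, s is first compared with its best
  continuation r from c on: by the closure assumption r survives in Ri, so optimality of s within
  Ri extends to all strategies reaching c.\<close>

lemma refine_belief: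
  assumes s: "s \<in> Strat G i" and cps0: "cps G i \<mu>0"
    and sb0: "\<And>B. B \<in> BB \<Longrightarrow> strong_belief i \<mu>0 B"
    and sub: "\<And>B. B \<in> BB \<Longrightarrow> RO \<subseteq> B"
    and opt0: "\<And>c. P \<Longrightarrow> c \<in> info G i \<Longrightarrow> s \<in> StratAt G i c \<Longrightarrow> best_at i v (\<mu>0 (OthAt G i c)) c s"
    and loc: "\<And>c. c \<in> info G i \<Longrightarrow> s \<in> StratAt G i c \<Longrightarrow> RO \<inter> OthAt G i c \<noteq> {} \<Longrightarrow>
      \<exists>w. (\<forall>y. 0 \<le> w y) \<and> (\<forall>y. y \<notin> RO \<inter> OthAt G i c \<longrightarrow> w y = 0) \<and> sum w (OthAt G i c) > 0 \<and>
        (\<forall>t\<in>Ri \<inter> StratAt G i c. ev i v w t \<le> ev i v w s)"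
    and closed: "\<And>r \<mu>. r \<in> Strat G i \<Longrightarrow> cps G i \<mu> \<Longrightarrow> (\<And>B. B \<in> BB \<Longrightarrow> strong_belief i \<mu> B) \<Longrightarrow>
      (\<And>c. P \<Longrightarrow> c \<in> info G i \<Longrightarrow> r \<in> StratAt G i c \<Longrightarrow> best_at i v (\<mu> (OthAt G i c)) c r) \<Longrightarrow> r \<in> Ri"
  shows "\<exists>\<mu>. cps G i \<mu> \<and> (\<forall>B\<in>insert RO BB. strong_belief i \<mu> B) \<and>
    (\<forall>c\<in>info G i. s \<in> StratAt G i c \<longrightarrow> P \<or> RO \<inter> OthAt G i c \<noteq> {} \<longrightarrow>
      best_at i v (\<mu> (OthAt G i c)) c s)"
proof -
  let ?O = "OthAt G i"
  let ?A = "{c \<in> info G i. s \<in> StratAt G i c \<and> RO \<inter> ?O c \<noteq> {}}"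
  let ?hit = "\<lambda>L c. \<exists>w\<in>set L. sum w (?O c) > 0"
  let ?ok = "\<lambda>L. (\<forall>w\<in>set L. \<forall>y. 0 \<le> w y) \<and> (\<forall>w\<in>set L. \<forall>y. y \<notin> RO \<longrightarrow> w y = 0)"
  \<comment> \<open>In the application \<open>P\<close> fails only at stage 0, where charged sets
    alone need optimality. Once \<open>P\<close> holds, the invariant also covers the sets still
    governed by \<open>\<mu>0\<close>.\<close>
  let ?opt = "\<lambda>L. \<forall>c\<in>info G i. s \<in> StratAt G i c \<longrightarrow> P \<or> ?hit L c \<longrightarrow>
    best_at i v (lex_cps L \<mu>0 (?O c)) c s"
  have cpsL: "cps G i (lex_cps L \<mu>0)" if "?ok L" for L
    using lex_cps_cps[OF cps0] that by blast
  have sbL: "strong_belief i (lex_cps L \<mu>0) B" if "?ok L" "B \<in> BB" for L B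
    using strong_belief_lex[OF sb0[OF that(2)]] that(1) sub[OF that(2)] by blast
  have "\<exists>L. ?ok L \<and> (\<forall>c\<in>?A. ?hit L c) \<and> ?opt L"
  proof (induction rule: finite_ranked_induct[where A = ?A and f = "depth i"])
    case 1
    show ?case using finite_info by simp
  next
    case 2
    show ?case using opt0 by (intro exI[of _ "[]"]) auto
  next
    case (3 D c)
    from 3(5) obtain L where L: "?ok L" "\<forall>c\<in>D. ?hit L c" "?opt L" by (elim exE conjE) simp
    have c: "c \<in> info G i" "s \<in> StratAt G i c" "RO \<inter> ?O c \<noteq> {}" using 3(2) by auto
    show ?case
    proof (cases "?hit L c")
      case True
      then show ?thesis using L by (intro exI[of _ L]) auto
    next
      case False
      obtain w where w: "\<forall>y. 0 \<le> w y" "\<forall>y. y \<notin> RO \<inter> ?O c \<longrightarrow> w y = 0" "sum w (?O c) > 0"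
        "\<forall>t\<in>Ri \<inter> StratAt G i c. ev i v w t \<le> ev i v w s"
        using loc[OF c] by blast
      let ?L = "L @ [w]"
      have okL: "?ok ?L" using L(1) w(1,2) by auto
      have hitL: "lex_cps ?L \<mu>0 (?O h) = lex_cps L \<mu>0 (?O h)" if "?hit L h" for h
        unfolding foldr_append by (rule lex_cps_hit[OF that])
      have nohitL: "lex_cps ?L \<mu>0 (?O h) = glue w \<mu>0 (?O h)" "lex_cps L \<mu>0 (?O h) = \<mu>0 (?O h)"
        if "\<not> ?hit L h" for h
        using lex_cps_no_hit[of L "?O h"] that by auto
      \<comment> \<open>An uncharged set of \<open>s\<close> that shares opponents with
        \<open>c\<close> cannot lie before \<open>c\<close>: it would then be consistent with
        \<open>RO\<close> and of smaller depth, hence already treated and charged.\<close>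
      have late: "prec i c h"
        if h: "h \<in> info G i" "s \<in> StratAt G i h" "\<not> ?hit L h" "?O c \<inter> ?O h \<noteq> {}" for h
      proof (cases "depth i c \<le> depth i h")
        case True
        then show ?thesis using info_comparable[OF c(1) h(1) c(2) h(2)] h(4) by blast
      next
        case False
        then have "prec i h c" using info_comparable[OF h(1) c(1) h(2) c(2)] h(4) by auto
        then have "?O c \<subseteq> ?O h" using OthAt_prec h(1) c(1) by blast
        then have "h \<in> ?A" using h c by blast
        then have "h \<in> D" using 3(4) False by auto
        then show ?thesis using L(2) h(3) by blast
      qed
      obtain r where r: "deviation i c s r"
        "\<And>h. h \<in> info G i \<Longrightarrow> prec i c h \<Longrightarrow> r \<in> StratAt G i h \<Longrightarrow>
          best_at i v (lex_cps ?L \<mu>0 (?O h)) h r"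
        using best_reply_from[OF cpsL[OF okL] c(1,2)] by blast
      have rc: "r \<in> StratAt G i c" using r(1) unfolding deviation_def by blast
      have rR: "r \<in> Ri"
      proof (rule closed[OF _ cpsL[OF okL] sbL[OF okL]])
        show "r \<in> Strat G i" using rc StratAt_subset by blast
        fix h assume P and h: "h \<in> info G i" "r \<in> StratAt G i h"
        show "best_at i v (lex_cps ?L \<mu>0 (?O h)) h r"
        proof (cases "prec i c h")
          case True
          then show ?thesis using r(2) h by blast
        next
          case prc: False
          then have sh: "s \<in> StratAt G i h" using r(1) h unfolding deviation_def by blast
          \<comment> \<open>At a set not following \<open>c\<close> the new weight changes nothing,
            and the opponents leading to \<open>c\<close> have probability 0, so \<open>r\<close>
            earns the same as \<open>s\<close> there.\<close>
          have "lex_cps ?L \<mu>0 (?O h) = lex_cps L \<mu>0 (?O h) \<and> (\<forall>y\<in>?O c. lex_cps L \<mu>0 (?O h) y = 0)"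
          proof (cases "?hit L h")
            case True
            have "lex_cps L \<mu>0 (?O h) y = 0" if "y \<in> ?O c" for y
              using lex_cps_zero[OF True _ _ finite_OthAt that] L(1) False by blast
            then show ?thesis using hitL[OF True] by blast
          next
            case nh: False
            then have dis: "?O c \<inter> ?O h = {}" using late[OF h(1) sh] prc by blast
            have "sum w (?O h) = 0" using w(2) dis by (intro sum.neutral) blast
            then have "lex_cps ?L \<mu>0 (?O h) = lex_cps L \<mu>0 (?O h)"
              using nohitL[OF nh] by (simp add: glue_def)
            moreover have "lex_cps L \<mu>0 (?O h) y = 0" if "y \<in> ?O c" for y
              using cps_zero[OF cpsL[OF L(1)] h(1)] dis that by blast
            ultimately show ?thesis by blast
          qed
          moreover from this have "ev i v (lex_cps L \<mu>0 (?O h)) r = ev i v (lex_cps L \<mu>0 (?O h)) s"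
            using deviation_ev_eq[OF r(1)] by blast
          moreover have "best_at i v (lex_cps L \<mu>0 (?O h)) h s" using L(3) h(1) sh \<open>P\<close> by blast
          ultimately show ?thesis unfolding best_at_def by simp
        qed
      qed
      have cond: "lex_cps ?L \<mu>0 (?O c) = condition w (?O c)"
        using nohitL[OF False] w(3) by (simp add: glue_def)
      have best: "best_at i v w c s"
        unfolding best_at_def
      proof
        fix t assume t: "t \<in> StratAt G i c"
        have "ev i v (condition w (?O c)) t \<le> ev i v (condition w (?O c)) r"
          using r(2)[OF c(1) prec_refl rc] t unfolding cond best_at_def by blast
        then have "ev i v w t \<le> ev i v w r"
          using w(2,3) by (simp add: ev_condition divide_le_cancel)
        also have "\<dots> \<le> ev i v w s" using w(4) rR rc by blast
        finally show "ev i v w t \<le> ev i v w s" .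
      qed
      have "?opt ?L"
      proof (intro ballI impI)
        fix h assume h: "h \<in> info G i" "s \<in> StratAt G i h" and Ph: "P \<or> ?hit ?L h"
        show "best_at i v (lex_cps ?L \<mu>0 (?O h)) h s"
        proof (cases "?hit L h")
          case True
          then show ?thesis using L(3) h hitL[OF True] by auto
        next
          case nh: False
          show ?thesis
          proof (cases "sum w (?O h) > 0")
            case True
            then obtain y where "y \<in> ?O h" "w y \<noteq> 0" by (metis less_irrefl sum.neutral)
            then have "?O c \<inter> ?O h \<noteq> {}" using w(2) by blast
            then have "prec i c h" using late[OF h nh] by blast
            then have "best_at i v (condition w (?O h)) h s"
              using best_at_condition[OF c(1) h(1) _ h(2) best True] by blast
            then show ?thesis using nohitL[OF nh] True by (simp add: glue_def)
          next
            case False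
            then have P using Ph nh by auto
            then show ?thesis using nohitL[OF nh] False opt0 h by (simp add: glue_def)
          qed
        qed
      qed
      moreover have "\<forall>d\<in>insert c D. ?hit ?L d" using L(2) w(3) by auto
      ultimately show ?thesis using okL by blast
    qed
  qed
  then obtain L where L: "?ok L" "\<forall>c\<in>?A. ?hit L c" "?opt L" by (elim exE conjE) simp
  \<comment> \<open>The weights in \<open>L\<close> are only known to charge the sets that
    \<open>s\<close> reaches, but strong belief concerns all sets consistent with \<open>RO\<close>.
    A uniform weight on \<open>RO\<close> in last place supplies the rest without touching the
    beliefs that \<open>L\<close> has fixed.\<close>
  let ?w = "\<lambda>y. if y \<in> RO then 1 else 0 :: real"
  let ?L = "L @ [?w]"
  have okL: "?ok ?L" using L(1) by auto
  have "strong_belief i (lex_cps ?L \<mu>0) RO"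
    unfolding strong_belief_def
  proof (intro ballI allI impI)
    fix c y assume c: "c \<in> info G i" "RO \<inter> ?O c \<noteq> {}" and y: "y \<notin> RO"
    have "sum ?w (?O c) > 0"
      using c(2) by (intro sum_pos2[of "?O c" "SOME y. y \<in> RO \<inter> ?O c"] finite_OthAt)
        (use some_in_eq[of "RO \<inter> ?O c"] in auto)
    then have "?hit ?L c" by auto
    \<comment> \<open>The base system need not strongly believe \<open>RO\<close>; as
      \<open>c\<close> is charged, the base may be replaced by the zero system, which does.\<close>
    then have "lex_cps ?L \<mu>0 (?O c) = lex_cps ?L (\<lambda>_ _. 0) (?O c)" by (rule lex_cps_hit)
    moreover have "strong_belief i (lex_cps ?L (\<lambda>_ _. 0)) RO"
      using okL by (intro strong_belief_lex) (auto simp: strong_belief_def)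
    ultimately show "lex_cps ?L \<mu>0 (?O c) y = 0" using c y unfolding strong_belief_def by simp
  qed
  moreover have "best_at i v (lex_cps ?L \<mu>0 (?O c)) c s"
    if c: "c \<in> info G i" "s \<in> StratAt G i c" "P \<or> RO \<inter> ?O c \<noteq> {}" for c
  proof (cases "?hit L c")
    case True
    then have "lex_cps ?L \<mu>0 (?O c) = lex_cps L \<mu>0 (?O c)"
      unfolding foldr_append by (rule lex_cps_hit)
    then show ?thesis using L(3) c True by auto
  next
    case False
    then have "RO \<inter> ?O c = {}" using L(2) c by blast
    moreover from this have "sum ?w (?O c) = 0" by (intro sum.neutral) auto
    ultimately show ?thesis using lex_cps_no_hit[of L "?O c"] False opt0 c by (simp add: glue_def)
  qed
  ultimately show ?thesis using cpsL[OF okL] sbL[OF okL] by (intro exI[of _ "lex_cps ?L \<mu>0"]) blast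
qed

section \<open>Extremely risk-averse utilities\<close>

lemma finite_terminal: "finite (terminal G)"
  using finite_hist by (rule rev_finite_subset) (auto simp: terminal_def)

definition rank :: "'i \<Rightarrow> ('i, 'a) hist \<Rightarrow> nat" where
  "rank i z = card {x \<in> terminal G. spref G i z x}"

lemma rank_le_iff:
  assumes z: "z \<in> terminal G" "z' \<in> terminal G"
  shows "rank i z' \<le> rank i z \<longleftrightarrow> pref G i z z'"
proof
  assume p: "pref G i z z'"
  have "{x \<in> terminal G. spref G i z' x} \<subseteq> {x \<in> terminal G. spref G i z x}"
    using p pref_trans[of _ _ _ i] z unfolding spref_def by blast
  then show "rank i z' \<le> rank i z" unfolding rank_def by (intro card_mono) (simp_all add: finite_terminal)
next
  assume le: "rank i z' \<le> rank i z"
  show "pref G i z z'"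
  proof (rule ccontr)
    assume n: "\<not> pref G i z z'"
    then have p: "pref G i z' z" using pref_total z by blast
    have "{x \<in> terminal G. spref G i z x} \<subseteq> {x \<in> terminal G. spref G i z' x}"
      using p pref_trans[of _ _ _ i] z unfolding spref_def by blast
    moreover have "z \<in> {x \<in> terminal G. spref G i z' x} - {x \<in> terminal G. spref G i z x}"
      using n p z unfolding spref_def by blast
    ultimately have "rank i z < rank i z'"
      unfolding rank_def by (intro psubset_card_mono) (auto simp: finite_terminal)
    then show False using le by simp
  qed
qed

text \<open>Sized for \<open>not_Bdom_best_reply\<close>: after weighting, a loss in one state is at
  least \<open>base i - 1\<close>, that is \<open>1 + card (Y i)\<close>, while the gains are at
  most 1 each and add up to at most \<open>card (Y i)\<close>.\<close>

definition base :: "'i \<Rightarrow> real" where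
  "base i = 2 + real (card (Y i))"

lemma base_gt_1: "base i > 1"
  unfolding base_def by simp

text \<open>Risk aversion this extreme lets a single loss outweigh a gain in every other state.\<close>

definition util :: "'i \<Rightarrow> ('i, 'a) hist \<Rightarrow> real" where
  "util i z = - ((1 / base i) ^ rank i z)"

lemma is_util_util: "is_util G i (util i)"
  unfolding is_util_def util_def
  using base_gt_1[of i] by (simp add: rank_le_iff[symmetric] power_decreasing_iff)

lemma not_Bdom_best_reply:
  assumes P: "P \<subseteq> Strat G i" and Q: "Q \<subseteq> Y i" and s: "s \<in> P" and nB: "\<not> Bdom G i P Q s"
  shows "\<exists>w. (\<forall>y. 0 \<le> w y) \<and> (\<forall>y. y \<notin> Q \<longrightarrow> w y = 0) \<and> sum w Q > 0 \<and>
    (\<forall>t\<in>P. ev i (util i) w t \<le> ev i (util i) w s)"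
proof -
  obtain Q' where Q': "Q' \<subseteq> Q" "Q' \<noteq> {}" "\<And>t. t \<in> P \<Longrightarrow> \<not> wdom G i P Q' t s"
    using nB s unfolding Bdom_def by blast
  let ?M = "base i"
  let ?r = "\<lambda>t y. rank i (outcome G (y(i := t)))"
  \<comment> \<open>Scaled so that \<open>s\<close> earns exactly -1 in every state of
    \<open>Q'\<close>. The gain of \<open>t\<close> in a state is then \<open>g y\<close> below:
    never more than 1, and at most \<open>1 - ?M\<close> where \<open>t\<close> is strictly
    worse.\<close>
  define w where "w y = (if y \<in> Q' then ?M ^ ?r s y else 0)" for y
  have M: "?M > 1" by (rule base_gt_1)
  have fin: "finite Q'" "finite Q" using Q'(1) Q finite_subset[OF _ finite_Oth] by blast+
  have w0: "0 \<le> w y" for y using M by (simp add: w_def)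
  have "\<exists>y\<in>Q. w y > 0" using Q' M by (auto simp: w_def)
  then have wpos: "sum w Q > 0" using w0 fin(2) by (meson sum_pos2)
  have "ev i (util i) w t \<le> ev i (util i) w s" if t: "t \<in> P" for t
  proof -
    define g where "g y = 1 - ?M ^ ?r s y * (1 / ?M) ^ ?r t y" for y
    have out: "outcome G (y(i := f)) \<in> terminal G" if "y \<in> Q'" "f \<in> P" for y f
      using outcome_terminal Prof_upd P Q Q'(1) that by blast
    have "ev i (util i) w t - ev i (util i) w s
        = (\<Sum>y\<in>Q'. util i (outcome G (y(i := t))) * w y) - (\<Sum>y\<in>Q'. util i (outcome G (y(i := s))) * w y)"
      using Q Q'(1) by (simp add: ev_restrict[of Q'] w_def)
    also have "\<dots> = (\<Sum>y\<in>Q'. g y)"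
      unfolding sum_subtractf[symmetric]
    proof (rule sum.cong[OF refl])
      fix y assume "y \<in> Q'"
      moreover have "(1 / ?M) ^ ?r s y * ?M ^ ?r s y = 1"
        using M by (simp add: power_mult_distrib[symmetric])
      ultimately show "util i (outcome G (y(i := t))) * w y - util i (outcome G (y(i := s))) * w y = g y"
        by (simp add: util_def w_def g_def mult.commute)
    qed
    also have "\<dots> \<le> 0"
    \<comment> \<open>If \<open>t\<close> is nowhere worse on \<open>Q'\<close>, its failure to
      dominate \<open>s\<close> forces indifference in every state; otherwise a single strict loss
      decides.\<close>
    proof (cases "\<forall>y\<in>Q'. pref G i (outcome G (y(i := t))) (outcome G (y(i := s)))")
      case True
      have "g y = 0" if y: "y \<in> Q'" for y
      proof -
        have "pref G i (outcome G (y(i := s))) (outcome G (y(i := t)))"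
          using Q'(3)[OF t] True y s t unfolding wdom_def spref_def by blast
        then have "?r s y = ?r t y"
          using True y rank_le_iff[OF out[OF y t] out[OF y s], of i]
            rank_le_iff[OF out[OF y s] out[OF y t], of i]
          by (simp add: order.antisym)
        then show ?thesis using M by (simp add: g_def power_mult_distrib[symmetric])
      qed
      then show ?thesis by simp
    next
      case False
      then obtain y0 where y0: "y0 \<in> Q'" "\<not> pref G i (outcome G (y0(i := t))) (outcome G (y0(i := s)))"
        by blast
      then have "?r t y0 < ?r s y0"
        using rank_le_iff[OF out[OF y0(1) t] out[OF y0(1) s], of i] by (simp add: not_le[symmetric])
      then obtain k where k: "?r s y0 = Suc (?r t y0 + k)" using less_iff_Suc_add by auto
      have "?M ^ ?r s y0 * (1 / ?M) ^ ?r t y0 = ?M * ?M ^ k"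
        unfolding k using M by (simp add: power_add power_one_over)
      moreover have "?M * 1 \<le> ?M * ?M ^ k" using M by (intro mult_left_mono) auto
      ultimately have g0: "g y0 \<le> 1 - ?M" by (simp add: g_def)
      have "(\<Sum>y\<in>Q' - {y0}. g y) \<le> (\<Sum>y\<in>Q' - {y0}. 1)"
        using M by (intro sum_mono) (simp add: g_def)
      also have "\<dots> \<le> real (card (Y i))"
        using card_mono[OF finite_Oth, of "Q' - {y0}" i] Q Q'(1) by auto
      finally show ?thesis using g0 sum.remove[OF fin(1) y0(1), of g] by (simp add: base_def)
    qed
    finally show ?thesis by simp
  qed
  then show ?thesis using w0 wpos Q'(1) by (intro exI[of _ w]) (auto simp: w_def)
qed

text \<open>The support of the belief serves as the test set: all its states have positive weight,
  so a strategy weakly dominating \<open>s\<close> on it would have strictly higher expected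
  utility.\<close>

lemma best_reply_not_Bdom:
  assumes P: "P \<subseteq> Strat G i" and Q: "Q \<subseteq> Y i" and s: "s \<in> P" and v: "is_util G i v"
    and w: "\<And>y. 0 \<le> w y" "\<And>y. y \<notin> Q \<Longrightarrow> w y = 0" "sum w Q > 0"
    and best: "\<And>t. t \<in> P \<Longrightarrow> ev i v w t \<le> ev i v w s"
  shows "\<not> Bdom G i P Q s"
proof
  assume B: "Bdom G i P Q s"
  let ?Q = "{y \<in> Q. w y > 0}"
  have fin: "finite ?Q" using finite_subset[OF Q finite_Oth] by simp
  have "?Q \<noteq> {}" using w(3) sum_nonpos[of Q w] by (force simp: not_less[symmetric])
  then obtain t where t: "t \<in> P" "wdom G i P ?Q t s"
    using B unfolding Bdom_def by (metis (no_types, lifting) mem_Collect_eq subsetI)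
  have v_iff: "v (outcome G (y(i := f))) \<ge> v (outcome G (y(i := g))) \<longleftrightarrow>
      pref G i (outcome G (y(i := f))) (outcome G (y(i := g)))"
    if "y \<in> Q" "f \<in> P" "g \<in> P" for y f g
    using v outcome_terminal Prof_upd P Q that unfolding is_util_def by (meson subsetD)
  have z: "w y = 0" if "y \<notin> ?Q" for y using that w(1)[of y] w(2)[of y] by force
  have QY: "?Q \<subseteq> Y i" using Q by blast
  have ev: "ev i v w f = (\<Sum>y\<in>?Q. v (outcome G (y(i := f))) * w y)" for f
    by (rule ev_restrict[OF _ QY]) (rule z)
  have "ev i v w s < ev i v w t"
    unfolding ev
  proof (rule sum_strict_mono_ex1[OF fin])
    show "\<forall>y\<in>?Q. v (outcome G (y(i := s))) * w y \<le> v (outcome G (y(i := t))) * w y"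
    proof
      fix y assume y: "y \<in> ?Q"
      then have "v (outcome G (y(i := s))) \<le> v (outcome G (y(i := t)))"
        using t(2) v_iff[OF _ t(1) s] unfolding wdom_def by blast
      then show "v (outcome G (y(i := s))) * w y \<le> v (outcome G (y(i := t))) * w y"
        using y by (simp add: mult_right_mono)
    qed
    obtain y where y: "y \<in> ?Q" "\<not> pref G i (outcome G (y(i := s))) (outcome G (y(i := t)))"
      using t(2) unfolding wdom_def spref_def by blast
    then have "v (outcome G (y(i := s))) < v (outcome G (y(i := t)))"
      using v_iff[OF _ s t(1)] by (force simp: not_le[symmetric])
    then show "\<exists>y\<in>?Q. v (outcome G (y(i := s))) * w y < v (outcome G (y(i := t))) * w y"
      using y(1) by (intro bexI[of _ y]) simp_all
  qed
  then show False using best[OF t(1)] by simp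
qed

section \<open>Comparison of the two procedures\<close>

lemma Uit_Suc: "Uit G (Suc n) = Uop G (Uit G n)"
  and SRit_Suc: "SRit G u (Suc n) = SRop G u (SRit G u n)"
  by (simp_all add: Uit_def SRit_def)

lemma Uit_antimono: "m \<le> n \<Longrightarrow> Uit G n i \<subseteq> Uit G m i"
  by (induction n rule: dec_induct) (auto simp: Uit_Suc Uop_def)

lemma Uit_subset_Strat: "Uit G n i \<subseteq> Strat G i"
  using Uit_antimono[of 0 n i] by (simp add: Uit_def)

lemma Oth_mono: "(\<And>j. R j \<subseteq> R' j) \<Longrightarrow> Oth R i \<subseteq> Oth R' i"
  unfolding Oth_def by (rule PiE_mono)

lemma Oth_Uit_subset: "Oth (Uit G n) i \<subseteq> Y i"
  by (rule Oth_mono) (rule Uit_subset_Strat)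

text \<open>Both procedures are compared with the strategies that are sequentially optimal among all
  strategies of the player, not only among the surviving ones, under a system that strongly
  believes each earlier stage. At stage 0 no optimality is required.\<close>

definition seq_rat :: "('i \<Rightarrow> ('i, 'a) hist \<Rightarrow> real) \<Rightarrow> nat \<Rightarrow> 'i \<Rightarrow> ('i, 'a) strat set" where
  "seq_rat u n i = {s \<in> Strat G i. \<exists>\<mu>. cps G i \<mu> \<and>
     (\<forall>m<n. strong_belief i \<mu> (Oth (Uit G m) i)) \<and>
     (0 < n \<longrightarrow> (\<forall>c\<in>info G i. s \<in> StratAt G i c \<longrightarrow> best_at i (u i) (\<mu> (OthAt G i c)) c s))}"

lemma seq_rat_0: "seq_rat u 0 i = Strat G i"
  using ex_cps unfolding seq_rat_def by auto

lemma seq_rat_Suc_subset: "seq_rat u (Suc n) i \<subseteq> seq_rat u n i"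
  unfolding seq_rat_def by (auto simp: less_Suc_eq)

lemma EU_eq_ev:
  assumes "R i \<subseteq> Strat G i" "Oth R i \<subseteq> Y i" "\<And>y. y \<notin> Oth R i \<Longrightarrow> \<mu> (OthAt G i c) y = 0"
  shows "EU G R u i \<mu> c t = ev i (u i) (\<mu> (OthAt G i c)) t"
  unfolding EU_def using ev_restrict[OF assms(3,2)] by simp

text \<open>The induction hypothesis enters twice: it supplies the system \<open>\<mu>0\<close>
  justifying \<open>s\<close> at stage \<open>n\<close>, and it recognises as survivors the
  deviations arising in \<open>refine_belief\<close>.\<close>

lemma Uit_Suc_seq_rat:
  assumes IH: "\<And>i. Uit G n i = seq_rat util n i"
  shows "Uit G (Suc n) i \<subseteq> seq_rat util (Suc n) i"
proof
  fix s assume s: "s \<in> Uit G (Suc n) i"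
  let ?RO = "Oth (Uit G n) i" and ?BB = "{Oth (Uit G m) i | m. m < n}"
  have sn: "s \<in> Uit G n i" "\<not> condB G (Uit G n) i s" using s unfolding Uit_Suc Uop_def by auto
  then have sS: "s \<in> Strat G i" using Uit_subset_Strat by blast
  obtain \<mu>0 where \<mu>0: "cps G i \<mu>0" "\<forall>m<n. strong_belief i \<mu>0 (Oth (Uit G m) i)"
    "0 < n \<Longrightarrow> \<forall>c\<in>info G i. s \<in> StratAt G i c \<longrightarrow> best_at i (util i) (\<mu>0 (OthAt G i c)) c s"
    using sn(1) unfolding IH seq_rat_def by blast
  have "\<exists>\<mu>. cps G i \<mu> \<and> (\<forall>B\<in>insert ?RO ?BB. strong_belief i \<mu> B) \<and>
    (\<forall>c\<in>info G i. s \<in> StratAt G i c \<longrightarrow> 0 < n \<or> ?RO \<inter> OthAt G i c \<noteq> {} \<longrightarrow>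
      best_at i (util i) (\<mu> (OthAt G i c)) c s)"
  proof (rule refine_belief[OF sS \<mu>0(1), where Ri = "Uit G n i"])
    show "strong_belief i \<mu>0 B" if "B \<in> ?BB" for B using that \<mu>0(2) by blast
    show "?RO \<subseteq> B" if B: "B \<in> ?BB" for B
    proof -
      obtain m where "m < n" "B = Oth (Uit G m) i" using B by blast
      then show ?thesis using Oth_mono[OF Uit_antimono[of m n]] by simp
    qed
    show "best_at i (util i) (\<mu>0 (OthAt G i c)) c s" if "0 < n" "c \<in> info G i" "s \<in> StratAt G i c" for c
      using \<mu>0(3) that by blast
  next
    fix c assume c: "c \<in> info G i" "s \<in> StratAt G i c" "?RO \<inter> OthAt G i c \<noteq> {}"
    have "\<not> Bdom G i (Uit G n i \<inter> StratAt G i c) (?RO \<inter> OthAt G i c) s"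
      using sn c unfolding condB_def Hs_def nonempty_at_def by blast
    then obtain w where w: "\<forall>y. 0 \<le> w y" "\<forall>y. y \<notin> ?RO \<inter> OthAt G i c \<longrightarrow> w y = 0"
      "sum w (?RO \<inter> OthAt G i c) > 0"
      "\<forall>t\<in>Uit G n i \<inter> StratAt G i c. ev i (util i) w t \<le> ev i (util i) w s"
      using not_Bdom_best_reply[of "Uit G n i \<inter> StratAt G i c" i "?RO \<inter> OthAt G i c" s]
        Uit_subset_Strat[of n i] OthAt_subset[of i c] sn(1) c(2) by blast
    moreover have "sum w (?RO \<inter> OthAt G i c) = sum w (OthAt G i c)"
      using w(2) by (intro sum.mono_neutral_left finite_OthAt) auto
    ultimately show "\<exists>w. (\<forall>y. 0 \<le> w y) \<and> (\<forall>y. y \<notin> ?RO \<inter> OthAt G i c \<longrightarrow> w y = 0) \<and>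
      sum w (OthAt G i c) > 0 \<and> (\<forall>t\<in>Uit G n i \<inter> StratAt G i c. ev i (util i) w t \<le> ev i (util i) w s)"
      by auto
  next
    fix r \<mu> assume "r \<in> Strat G i" "cps G i \<mu>" "\<And>B. B \<in> ?BB \<Longrightarrow> strong_belief i \<mu> B"
      "\<And>c. 0 < n \<Longrightarrow> c \<in> info G i \<Longrightarrow> r \<in> StratAt G i c \<Longrightarrow>
        best_at i (util i) (\<mu> (OthAt G i c)) c r"
    then show "r \<in> Uit G n i" unfolding IH seq_rat_def by blast
  qed
  then obtain \<mu> where \<mu>: "cps G i \<mu>" "\<And>B. B \<in> insert ?RO ?BB \<Longrightarrow> strong_belief i \<mu> B"
    "\<And>c. c \<in> info G i \<Longrightarrow> s \<in> StratAt G i c \<Longrightarrow> 0 < n \<or> ?RO \<inter> OthAt G i c \<noteq> {} \<Longrightarrow>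
      best_at i (util i) (\<mu> (OthAt G i c)) c s" by blast
  have "strong_belief i \<mu> (Oth (Uit G m) i)" if "m < Suc n" for m
    using that \<mu>(2) by (auto simp: less_Suc_eq)
  \<comment> \<open>At stage 0 the set \<open>?RO\<close> contains all opponent profiles, so every
    information set is consistent with it.\<close>
  moreover have "0 < n \<or> ?RO \<inter> OthAt G i c \<noteq> {}" if "c \<in> info G i" for c
    using OthAt_nonempty[OF that] OthAt_subset[of i c] by (cases n) (auto simp: Uit_def)
  ultimately show "s \<in> seq_rat util (Suc n) i" using sS \<mu>(1,3) unfolding seq_rat_def by blast
qed

text \<open>Optimality among all strategies restricts to the survivors, and strong belief removes
  the profiles outside the restriction, so that \<open>ev\<close> and \<open>EU\<close>
  agree.\<close>

lemma seq_rat_SRop: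
  assumes "s \<in> seq_rat u (Suc n) i" "s \<in> Uit G n i"
  shows "s \<in> SRop G u (Uit G n) i"
proof -
  let ?R = "Uit G n"
  obtain \<mu> where \<mu>: "cps G i \<mu>" "strong_belief i \<mu> (Oth ?R i)"
    "\<And>c. c \<in> info G i \<Longrightarrow> s \<in> StratAt G i c \<Longrightarrow> best_at i (u i) (\<mu> (OthAt G i c)) c s"
    using assms(1) unfolding seq_rat_def by blast
  have "cps_on G ?R i \<mu>"
    unfolding cps_on_def nonempty_at_def using \<mu>(1) strong_belief_sum[OF \<mu>(2,1)] by blast
  moreover have "EU G ?R u i \<mu> c t \<le> EU G ?R u i \<mu> c s"
    if c: "c \<in> Hs G i s" "nonempty_at G ?R i c" and t: "t \<in> ?R i \<inter> StratAt G i c" for c t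
  proof -
    have "\<mu> (OthAt G i c) y = 0" if "y \<notin> Oth ?R i" for y
      using \<mu>(2) c that unfolding strong_belief_def Hs_def nonempty_at_def by blast
    then show ?thesis using \<mu>(3) c(1) t EU_eq_ev[OF Uit_subset_Strat Oth_Uit_subset]
      unfolding Hs_def best_at_def by simp
  qed
  ultimately show ?thesis unfolding SRop_def using assms(2) by blast
qed

text \<open>Each conditional belief that counts is concentrated on the remaining opponents reaching
  \<open>c\<close>, and its support refutes B-dominance there, whatever utility represents the
  preferences.\<close>

lemma SRop_Uop:
  assumes R: "\<And>j. R j \<subseteq> Strat G j" and u: "is_util G i (u i)" and s: "s \<in> SRop G u R i"
  shows "s \<in> Uop G R i"
proof -
  obtain \<mu> where sR: "s \<in> R i" and \<mu>: "cps_on G R i \<mu>"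
    "\<And>c t. c \<in> Hs G i s \<Longrightarrow> nonempty_at G R i c \<Longrightarrow> t \<in> R i \<inter> StratAt G i c \<Longrightarrow>
      EU G R u i \<mu> c t \<le> EU G R u i \<mu> c s"
    using s unfolding SRop_def by blast
  have cps: "cps G i \<mu>" using \<mu>(1) unfolding cps_on_def by blast
  have OY: "Oth R i \<subseteq> Y i" by (rule Oth_mono) (rule R)
  have "\<not> Bdom G i (R i \<inter> StratAt G i c) (Oth R i \<inter> OthAt G i c) s"
    if c: "c \<in> Hs G i s" "nonempty_at G R i c" for c
  proof -
    let ?w = "\<mu> (OthAt G i c)" and ?Q = "Oth R i \<inter> OthAt G i c"
    have ci: "c \<in> info G i" "s \<in> StratAt G i c" using c(1) unfolding Hs_def by auto
    have one: "sum ?w ?Q = 1" using \<mu>(1) ci(1) c(2) unfolding cps_on_def by blast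
    have "sum ?w (OthAt G i c - ?Q) = sum ?w (OthAt G i c) - sum ?w ?Q"
      by (rule sum_diff[OF finite_OthAt]) blast
    then have "sum ?w (OthAt G i c - ?Q) = 0" using one cps_sum[OF cps ci(1)] by simp
    moreover have "finite (OthAt G i c - ?Q)" using finite_OthAt by blast
    ultimately have "\<forall>y\<in>OthAt G i c - ?Q. ?w y = 0"
      using sum_nonneg_eq_0_iff[of "OthAt G i c - ?Q" ?w] cps_nonneg[OF cps ci(1)] by simp
    then have z: "?w y = 0" if "y \<notin> ?Q" for y using cps_zero[OF cps ci(1)] that by blast
    have eq: "EU G R u i \<mu> c t = ev i (u i) ?w t" for t
      using z by (intro EU_eq_ev R OY) blast
    show ?thesis
    proof (rule best_reply_not_Bdom[OF _ _ _ u, where w = ?w])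
      show "R i \<inter> StratAt G i c \<subseteq> Strat G i" using R by blast
      show "?Q \<subseteq> Y i" using OY by blast
      show "s \<in> R i \<inter> StratAt G i c" using sR ci by blast
      show "ev i (u i) ?w t \<le> ev i (u i) ?w s" if "t \<in> R i \<inter> StratAt G i c" for t
        using \<mu>(2)[OF c that] unfolding eq .
    qed (use cps_nonneg[OF cps ci(1)] z one in auto)
  qed
  then show ?thesis unfolding Uop_def condB_def using sR by blast
qed

text \<open>Closes the cycle of inclusions from \<open>Uit\<close> through \<open>seq_rat\<close>
  and \<open>SRit\<close> back to \<open>Uit\<close>. The statement about \<open>seq_rat\<close> is
  carried along because it turns sequential optimality at stage \<open>n\<close> into membership in
  the current restriction.\<close>

lemma Uit_eq:
  "(\<forall>i. Uit G n i = seq_rat util n i) \<and> Uit G n = SRit G util n"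
proof (induction n)
  case 0
  show ?case by (simp add: seq_rat_0) (simp add: Uit_def SRit_def)
next
  case (Suc n)
  have "Uit G (Suc n) i \<subseteq> seq_rat util (Suc n) i" for i
    using Uit_Suc_seq_rat Suc.IH by blast
  moreover have "seq_rat util (Suc n) i \<subseteq> SRit G util (Suc n) i" for i
    using seq_rat_SRop[of _ util n i] seq_rat_Suc_subset[of util n i] Suc.IH
    unfolding SRit_Suc by fastforce
  moreover have "SRit G util (Suc n) i \<subseteq> Uit G (Suc n) i" for i
    using SRop_Uop[of "Uit G n" i util] Uit_subset_Strat is_util_util Suc.IH
    unfolding SRit_Suc Uit_Suc by fastforce
  ultimately show ?case by (intro conjI allI ext) (meson subset_antisym subset_trans)+
qed

end

theorem theorem3:
  fixes G :: "('i::finite, 'a) game"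
  assumes "wf_game G"
  shows "\<exists>u. (\<forall>j. is_util G j (u j)) \<and> (\<forall>i k. Uit G k i = SRit G u k i)"
proof -
  interpret ordinal_game G using assms by unfold_locales
  show ?thesis using is_util_util Uit_eq by (intro exI[of _ util]) auto
qed

end
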